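(* For any $t_1,t_2\in\mathbb{R}$ and $s_1,s_2>0$, $$\mathrm{Cov}\left(|W_Y(t_1,s_1)|^2,|W_Y(t_2,s_2)|^2\right)=\sum_{\Box,\triangle\in\{\Re,\Im\}}\Big\{4\,\Box(W_f(t_1,s_1))\,\triangle(W_f(t_2,s_2))\sqrt{s_1s_2}\int_{\mathbb{R}}e^{i(t_1-t_2)\lambda}\,\overline{\widehat{\Box(\psi)}(s_1\lambda)}\,\widehat{\triangle(\psi)}(s_2\lambda)\,F(d\lambda)+2s_1s_2\left[\int_{\mathbb{R}}e^{i(t_1-t_2)u}\,\overline{\widehat{\Box(\psi)}(s_1u)}\,\widehat{\triangle(\psi)}(s_2u)\,F(du)\right]^2\Big\},$$ where $F$ is the spectral measure of $C_\Phi$.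
   Context: The mother wavelet $\psi:\mathbb{R}\to\mathbb{C}$ (not necessarily analytic) belongs to $L^1(\mathbb{R})\cap L^2(\mathbb{R})$ and satisfies $\int_{\mathbb{R}}\psi(u)\,du=0$. For an integrable function $g$, $\widehat g(\omega)=\int_{\mathbb{R}}e^{-it\omega}g(t)\,dt$. $\Re$ and $\Im$ denote the real and imaginary parts, applied pointwise to functions, so that $\Re(\psi)$ and $\Im(\psi)$ are real-valued functions on $\mathbb{R}$. The function $f:\mathbb{R}\to\mathbb{R}$ is bounded and deterministic. The noise $\Phi=\{\Phi(t)\}_{t\in\mathbb{R}}$ is a real-valued stationary Gaussian process with constant mean and covariance function $C_\Phi(t_1-t_2)=\mathrm{Cov}(\Phi(t_1),\Phi(t_2))$, which has the spectral representation $C_\Phi(t)=\int_{\mathbb{R}}e^{i\lambda t}F(d\lambda)$, where the spectral measure $F$ is the unique nonnegative measure on $\mathbb{R}$ with this property, $F(\mathbb{R})=C_\Phi(0)$. The observed signal is $Y=f+\Phi$. For $g\in\{f,\Phi,Y\}$, the wavelet transform is $W_g(t,s)=\int_{\mathbb{R}}g(\tau)\frac{1}{\sqrt s}\overline{\psi\left(\frac{\tau-t}{s}\right)}d\tau$, $t\in\mathbb{R}$, $s>0$.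
   Formalization: In the first term, □(W_f) and △(W_f) are replaced by □ and △ of the complex conjugate of W_f, since the printed formula has the wrong sign in the mixed ℜ/ℑ terms; f is taken measurable and Φ jointly measurable so that the integrals make sense. *)

theory Defs
  imports "HOL-Probability.Probability"
begin

definition covariance :: "'a measure \<Rightarrow> ('a \<Rightarrow> real) \<Rightarrow> ('a \<Rightarrow> real) \<Rightarrow> real" where
  "covariance M X Y =
     (\<integral>\<omega>. (X \<omega> - (\<integral>\<omega>'. X \<omega>' \<partial>M)) * (Y \<omega> - (\<integral>\<omega>'. Y \<omega>' \<partial>M)) \<partial>M)"

(* Almost surely constant variables count as (degenerate) Gaussians. *)
definition gaussian_variable :: "'a measure \<Rightarrow> ('a \<Rightarrow> real) \<Rightarrow> bool" where
  "gaussian_variable M X \<longleftrightarrow> X \<in> borel_measurable M \<and>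
     ((\<exists>\<mu>. AE \<omega> in M. X \<omega> = \<mu>) \<or>
      (\<exists>\<mu> \<sigma>. 0 < \<sigma> \<and> distributed M lborel X (normal_density \<mu> \<sigma>)))"

definition gaussian_process :: "'a measure \<Rightarrow> (real \<Rightarrow> 'a \<Rightarrow> real) \<Rightarrow> bool" where
  "gaussian_process M \<Phi> \<longleftrightarrow>
     (\<forall>T c. finite T \<longrightarrow> gaussian_variable M (\<lambda>\<omega>. \<Sum>t\<in>T. c t * \<Phi> t \<omega>))"

definition stationary_with_covariance ::
    "'a measure \<Rightarrow> (real \<Rightarrow> 'a \<Rightarrow> real) \<Rightarrow> (real \<Rightarrow> real) \<Rightarrow> bool" where
  "stationary_with_covariance M \<Phi> C \<longleftrightarrow>
     (\<exists>\<mu>. \<forall>t. (\<integral>\<omega>. \<Phi> t \<omega> \<partial>M) = \<mu>) \<and>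
     (\<forall>t1 t2. covariance M (\<Phi> t1) (\<Phi> t2) = C (t1 - t2))"

(* The value at t = 0 gives measure F UNIV = C 0. *)
definition spectral_measure_of :: "(real \<Rightarrow> real) \<Rightarrow> real measure \<Rightarrow> bool" where
  "spectral_measure_of C F \<longleftrightarrow> finite_measure F \<and> sets F = sets borel \<and>
     (\<forall>t. complex_of_real (C t) = (CLINT x|F. iexp (t * x)))"

definition mother_wavelet :: "(real \<Rightarrow> complex) \<Rightarrow> bool" where
  "mother_wavelet \<psi> \<longleftrightarrow> integrable lebesgue \<psi> \<and>
     integrable lebesgue (\<lambda>u. (cmod (\<psi> u))\<^sup>2) \<and> (CLINT u|lebesgue. \<psi> u) = 0"

definition fourier :: "(real \<Rightarrow> real) \<Rightarrow> real \<Rightarrow> complex" where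
  "fourier g w = (CLINT t|lebesgue. iexp (- (t * w)) * complex_of_real (g t))"

(* The kernel is the conjugate of \<psi>.  Hence, for real g, the integrals of g against the
   rescaled Re \<psi> and Im \<psi> are Re (W g t s) and - Im (W g t s), that is, the real and
   imaginary parts of cnj (W g t s), where W = wavelet_transform \<psi>.  A formula pairing these
   components with the Fourier transforms of Re \<psi> and Im \<psi> needs this sign in its mixed
   terms. *)
definition wavelet_transform ::
    "(real \<Rightarrow> complex) \<Rightarrow> (real \<Rightarrow> real) \<Rightarrow> real \<Rightarrow> real \<Rightarrow> complex" where
  "wavelet_transform \<psi> g t s =
     (CLINT \<tau>|lebesgue. complex_of_real (g \<tau>) * complex_of_real (1 / sqrt s) *
        cnj (\<psi> ((\<tau> - t) / s)))"

end

theory Submission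
  imports Defs
begin

text \<open>
  Write \<open>\<Psi>\<close> for the centred noise. Since the wavelet has integral zero, the component
  \<open>p \<in> {Re, Im}\<close> of the conjugate of \<open>W_Y(t, s)\<close> is almost surely the constant \<open>a_p\<close>, the same component for the
  signal \<open>f\<close>, plus the random variable \<open>X_p = \<integral> h_p(\<tau>) \<Psi>(\<tau>) d\<tau>\<close>, where \<open>h_p\<close> is the component \<open>p\<close> of the
  rescaled wavelet (\<open>noisy_wavelet_component\<close>). Hence the scalogram is \<open>\<Sum>_p (a_p + X_p)^2\<close>, and likewise
  \<open>\<Sum>_q (b_q + Y_q)^2\<close> at the second point. As the covariance is bilinear, everything reduces to
  \<open>Cov((a + X)^2, (b + Y)^2) = 4ab E[XY] + 2 E[XY]^2\<close> for centred jointly Gaussian \<open>X\<close> and \<open>Y\<close>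
  (\<open>covariance_shifted_squares\<close>), and to the value of \<open>E[XY]\<close>.

  The first point follows from \<open>E[X^2 Y^2] = E[X^2] E[Y^2] + 2 E[XY]^2\<close> and \<open>E[X Y^2] = E[X^2 Y] = 0\<close>.
  These moments are multilinear in the random variables. By Fubini's theorem a moment of
  integrals \<open>\<integral> h \<Psi>\<close> is an integral of mixed moments of the process at fixed times, so it suffices to know
  Isserlis' formula \<open>E[abcd] = E[ab] E[cd] + E[ac] E[bd] + E[ad] E[bc]\<close> there. It follows by polarization from
  \<open>E[Z^4] = 3 E[Z^2]^2\<close> for linear combinations \<open>Z\<close> of finitely many values of the process, which are
  normal by assumption (\<open>wick\<close>, \<open>centred_gaussian_process_moments\<close>). The integrals replace the values of the
  process one factor at a time (\<open>smear_fubini\<close>, \<open>wick4_smear\<close>); the integrability that this requires is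
  that each factor has a finite fourth moment (\<open>L4_smear\<close>).

  For the second point, \<open>E[XY]\<close> is the double integral of \<open>h(t) k(u) C(t - u)\<close>. Inserting the spectral
  representation of \<open>C\<close> turns it into the \<open>F\<close>-integral of a product of Fourier transforms
  (\<open>spectral_double_integral\<close>), and an affine substitution relates these to the transforms of the
  components of the mother wavelet (\<open>smeared_atoms_covariance\<close>).
\<close>

section \<open>Fourth-power integrable random variables\<close>
definition L4 :: "'a measure \<Rightarrow> ('a \<Rightarrow> real) \<Rightarrow> bool" where
  "L4 M Z \<longleftrightarrow> Z \<in> borel_measurable M \<and> integrable M (\<lambda>\<omega>. Z \<omega> ^ 4)"

lemma L4_measurable: "L4 M Z \<Longrightarrow> Z \<in> borel_measurable M"
  by (simp add: L4_def)

text \<open>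
  A cheap Hoelder inequality: being in \<open>L4\<close> is a condition on each factor separately, and it makes
  all mixed moments up to order four finite.
\<close>
lemma abs_mult4_le: "\<bar>a * b * c * d\<bar> \<le> a ^ 4 + b ^ 4 + c ^ 4 + d ^ 4" for a b c d :: real
proof -
  have two: "\<bar>x * y\<bar> \<le> x\<^sup>2 + y\<^sup>2" for x y :: real
    using sum_squares_ge_zero[of x y] zero_le_power2[of "x + y"] zero_le_power2[of "x - y"]
    unfolding power2_sum power2_diff abs_le_iff by simp
  have four: "(x\<^sup>2)\<^sup>2 = x ^ 4" for x :: real by simp
  have "\<bar>a * b * c * d\<bar> = \<bar>(a * b) * (c * d)\<bar>"
    by (simp only: mult.assoc)
  also have "\<dots> \<le> (a * b)\<^sup>2 + (c * d)\<^sup>2"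
    by (rule two)
  also have "(a * b)\<^sup>2 \<le> a ^ 4 + b ^ 4"
    using two[of "a\<^sup>2" "b\<^sup>2"] by (simp add: power_mult_distrib)
  also have "(c * d)\<^sup>2 \<le> c ^ 4 + d ^ 4"
    using two[of "c\<^sup>2" "d\<^sup>2"] by (simp add: power_mult_distrib)
  finally show ?thesis by simp
qed

lemma L4_integrable_mult4:
  assumes "L4 M a" "L4 M b" "L4 M c" "L4 M d"
  shows "integrable M (\<lambda>\<omega>. a \<omega> * b \<omega> * c \<omega> * d \<omega>)"
proof (rule Bochner_Integration.integrable_bound)
  show "integrable M (\<lambda>\<omega>. a \<omega> ^ 4 + b \<omega> ^ 4 + c \<omega> ^ 4 + d \<omega> ^ 4)"
    using assms by (simp add: L4_def)
  show "(\<lambda>\<omega>. a \<omega> * b \<omega> * c \<omega> * d \<omega>) \<in> borel_measurable M"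
    using assms[THEN L4_measurable] by measurable
  show "AE \<omega> in M. norm (a \<omega> * b \<omega> * c \<omega> * d \<omega>) \<le> norm (a \<omega> ^ 4 + b \<omega> ^ 4 + c \<omega> ^ 4 + d \<omega> ^ 4)"
    using abs_mult4_le by (auto simp: abs_of_nonneg intro!: order_trans[OF abs_mult4_le])
qed

lemma L4_add:
  assumes "L4 M a" "L4 M b"
  shows "L4 M (\<lambda>\<omega>. a \<omega> + b \<omega>)"
proof -
  have "(x + y) ^ 4 = x*x*x*x + 4*(x*x*x*y) + 6*(x*x*y*y) + 4*(x*y*y*y) + y*y*y*y" for x y :: real
    by algebra
  then have "integrable M (\<lambda>\<omega>. (a \<omega> + b \<omega>) ^ 4)"
    using assms by (simp add: L4_integrable_mult4)
  moreover have "(\<lambda>\<omega>. a \<omega> + b \<omega>) \<in> borel_measurable M"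
    using assms[THEN L4_measurable] by measurable
  ultimately show ?thesis by (simp add: L4_def)
qed

lemma L4_minus: "L4 M a \<Longrightarrow> L4 M (\<lambda>\<omega>. - a \<omega>)"
  by (simp add: L4_def)

lemma L4_diff: "L4 M a \<Longrightarrow> L4 M b \<Longrightarrow> L4 M (\<lambda>\<omega>. a \<omega> - b \<omega>)"
  using L4_add[OF _ L4_minus, of M a b] by simp

lemma (in prob_space) L4_const: "L4 M (\<lambda>_. k)"
  by (simp add: L4_def)

lemmas (in prob_space) L4_one = L4_const[of 1]

lemma (in prob_space) L4_integrable:
  assumes "L4 M a" shows "integrable M a"
  using L4_integrable_mult4[OF assms L4_one L4_one L4_one] by simp

lemma (in prob_space) L4_integrable_mult2:
  assumes "L4 M a" "L4 M b" shows "integrable M (\<lambda>\<omega>. a \<omega> * b \<omega>)"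
  using L4_integrable_mult4[OF assms L4_one L4_one] by simp

lemma (in prob_space) L4_integrable_mult3:
  assumes "L4 M a" "L4 M b" "L4 M c" shows "integrable M (\<lambda>\<omega>. a \<omega> * b \<omega> * c \<omega>)"
  using L4_integrable_mult4[OF assms L4_one] by simp

section \<open>Isserlis' formula by polarization\<close>

text \<open>
  Isserlis' (Wick's) formula for the fourth mixed moment of centred jointly Gaussian variables: the
  sum runs over the three pairings of four factors.
\<close>
definition wick4 where
  "wick4 M a b c d \<longleftrightarrow> (\<integral>\<omega>. a \<omega> * b \<omega> * c \<omega> * d \<omega> \<partial>M) =
     (\<integral>\<omega>. a \<omega> * b \<omega> \<partial>M) * (\<integral>\<omega>. c \<omega> * d \<omega> \<partial>M) +
     (\<integral>\<omega>. a \<omega> * c \<omega> \<partial>M) * (\<integral>\<omega>. b \<omega> * d \<omega> \<partial>M) +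
     (\<integral>\<omega>. a \<omega> * d \<omega> \<partial>M) * (\<integral>\<omega>. b \<omega> * c \<omega> \<partial>M :: real)"

text \<open>
  For a centred variable this says that the kurtosis has its Gaussian value \<open>3\<close>; the degenerate
  variable \<open>0\<close> is included.
\<close>
definition kurtosis3 where
  "kurtosis3 M Z \<longleftrightarrow> (\<integral>\<omega>. Z \<omega> ^ 4 \<partial>M) = 3 * (\<integral>\<omega>. Z \<omega> ^ 2 \<partial>M :: real)\<^sup>2"

text \<open>
  Polarization: \<open>(X + Y)^4 + (X - Y)^4\<close> contains \<open>12 X^2 Y^2\<close> and otherwise only fourth powers of
  \<open>X\<close> and \<open>Y\<close>, and each of the four fourth moments is a function of second moments.
\<close>
lemma (in prob_space) wick_pair:
  assumes L: "L4 M X" "L4 M Y"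
    and K: "kurtosis3 M X" "kurtosis3 M Y"
      "kurtosis3 M (\<lambda>\<omega>. X \<omega> + Y \<omega>)" "kurtosis3 M (\<lambda>\<omega>. X \<omega> - Y \<omega>)"
  shows "expectation (\<lambda>\<omega>. (X \<omega>)\<^sup>2 * (Y \<omega>)\<^sup>2) =
    expectation (\<lambda>\<omega>. (X \<omega>)\<^sup>2) * expectation (\<lambda>\<omega>. (Y \<omega>)\<^sup>2) + 2 * (expectation (\<lambda>\<omega>. X \<omega> * Y \<omega>))\<^sup>2"
proof -
  define A B C where "A = expectation (\<lambda>\<omega>. (X \<omega>)\<^sup>2)" and "B = expectation (\<lambda>\<omega>. X \<omega> * Y \<omega>)"
    and "C = expectation (\<lambda>\<omega>. (Y \<omega>)\<^sup>2)"
  have i4: "integrable M (\<lambda>\<omega>. X \<omega> ^ 4)" "integrable M (\<lambda>\<omega>. Y \<omega> ^ 4)"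
    "integrable M (\<lambda>\<omega>. (X \<omega> + Y \<omega>) ^ 4)" "integrable M (\<lambda>\<omega>. (X \<omega> - Y \<omega>) ^ 4)"
    using L L4_add[OF L] L4_diff[OF L] by (simp_all add: L4_def)
  have i2: "integrable M (\<lambda>\<omega>. (X \<omega>)\<^sup>2)" "integrable M (\<lambda>\<omega>. X \<omega> * Y \<omega>)" "integrable M (\<lambda>\<omega>. (Y \<omega>)\<^sup>2)"
    unfolding power2_eq_square using L by (simp_all add: L4_integrable_mult2)
  have i22: "integrable M (\<lambda>\<omega>. (X \<omega>)\<^sup>2 * (Y \<omega>)\<^sup>2)"
    using L4_integrable_mult4[OF L(1) L(1) L(2) L(2)] by (simp add: power2_eq_square mult.assoc)
  have sq: "expectation (\<lambda>\<omega>. (X \<omega> + Y \<omega>)\<^sup>2) = A + 2 * B + C"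
    "expectation (\<lambda>\<omega>. (X \<omega> - Y \<omega>)\<^sup>2) = A - 2 * B + C"
    using i2 by (simp_all add: power2_sum power2_diff A_def B_def C_def mult.assoc)
  have "(x + y) ^ 4 + (x - y) ^ 4 = 2 * x ^ 4 + 12 * (x\<^sup>2 * y\<^sup>2) + 2 * y ^ 4" for x y :: real
    by algebra
  then have "expectation (\<lambda>\<omega>. (X \<omega> + Y \<omega>) ^ 4 + (X \<omega> - Y \<omega>) ^ 4) =
     expectation (\<lambda>\<omega>. 2 * X \<omega> ^ 4 + 12 * ((X \<omega>)\<^sup>2 * (Y \<omega>)\<^sup>2) + 2 * Y \<omega> ^ 4)"
    by simp
  then have "expectation (\<lambda>\<omega>. (X \<omega> + Y \<omega>) ^ 4) + expectation (\<lambda>\<omega>. (X \<omega> - Y \<omega>) ^ 4) =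
     2 * expectation (\<lambda>\<omega>. X \<omega> ^ 4) + 12 * expectation (\<lambda>\<omega>. (X \<omega>)\<^sup>2 * (Y \<omega>)\<^sup>2) + 2 * expectation (\<lambda>\<omega>. Y \<omega> ^ 4)"
    using i4 i22 by simp
  then have "3 * (A + 2 * B + C)\<^sup>2 + 3 * (A - 2 * B + C)\<^sup>2 =
     2 * (3 * A\<^sup>2) + 12 * expectation (\<lambda>\<omega>. (X \<omega>)\<^sup>2 * (Y \<omega>)\<^sup>2) + 2 * (3 * C\<^sup>2)"
    using K unfolding kurtosis3_def sq by (simp add: A_def C_def)
  then show ?thesis
    unfolding A_def[symmetric] B_def[symmetric] C_def[symmetric] by algebra
qed

text \<open>
  The form in which joint normality enters: every element of a family that is closed under sums and
  differences has the third and fourth moments of a centred Gaussian variable with its variance.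
\<close>
locale gaussian_moment_space = prob_space M for M :: "'a measure" +
  fixes S :: "('a \<Rightarrow> real) set"
  assumes L4: "Z \<in> S \<Longrightarrow> L4 M Z"
    and add: "\<lbrakk>X \<in> S; Y \<in> S\<rbrakk> \<Longrightarrow> (\<lambda>\<omega>. X \<omega> + Y \<omega>) \<in> S"
    and diff: "\<lbrakk>X \<in> S; Y \<in> S\<rbrakk> \<Longrightarrow> (\<lambda>\<omega>. X \<omega> - Y \<omega>) \<in> S"
    and third: "Z \<in> S \<Longrightarrow> expectation (\<lambda>\<omega>. Z \<omega> ^ 3) = 0"
    and fourth: "Z \<in> S \<Longrightarrow> kurtosis3 M Z"
begin

lemma pair_squares:
  assumes "X \<in> S" "Y \<in> S"
  shows "expectation (\<lambda>\<omega>. (X \<omega>)\<^sup>2 * (Y \<omega>)\<^sup>2) =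
    expectation (\<lambda>\<omega>. (X \<omega>)\<^sup>2) * expectation (\<lambda>\<omega>. (Y \<omega>)\<^sup>2) + 2 * (expectation (\<lambda>\<omega>. X \<omega> * Y \<omega>))\<^sup>2"
  using assms by (intro wick_pair L4 fourth add diff)

text \<open>
  \<open>16abcd = ((a + b)^2 - (a - b)^2) ((c + d)^2 - (c - d)^2)\<close> expands into products of two squares,
  for which the formula is known.
\<close>
lemma wick:
  assumes S: "a \<in> S" "b \<in> S" "c \<in> S" "d \<in> S"
  shows "wick4 M a b c d"
proof -
  let ?E = "\<lambda>x y. expectation (\<lambda>\<omega>. x \<omega> * y \<omega>)"
  have i2: "integrable M (\<lambda>\<omega>. x \<omega> * y \<omega>)" if "x \<in> S" "y \<in> S" for x y
    using that by (intro L4_integrable_mult2 L4)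
  have i4: "integrable M (\<lambda>\<omega>. (x \<omega>)\<^sup>2 * (y \<omega>)\<^sup>2)" if "x \<in> S" "y \<in> S" for x y
    using L4_integrable_mult4[of M x x y y] that by (simp add: L4 power2_eq_square mult.assoc)
  have sq: "(x + y)\<^sup>2 = x * x + 2 * (x * y) + y * y" "(x - y)\<^sup>2 = x * x - 2 * (x * y) + y * y" for x y :: real
    by algebra+
  have pp: "(x + y) * (z + w) = x * z + x * w + y * z + y * w"
    "(x + y) * (z - w) = x * z - x * w + y * z - y * w"
    "(x - y) * (z + w) = x * z + x * w - y * z - y * w"
    "(x - y) * (z - w) = x * z - x * w - y * z + y * w" for x y z w :: real
    by algebra+
  have id: "16 * (x * y * z * w) = (x + y)\<^sup>2 * (z + w)\<^sup>2 - (x + y)\<^sup>2 * (z - w)\<^sup>2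
      - (x - y)\<^sup>2 * (z + w)\<^sup>2 + (x - y)\<^sup>2 * (z - w)\<^sup>2" for x y z w :: real
    by algebra
  let ?p = "\<lambda>\<omega>. a \<omega> + b \<omega>" and ?m = "\<lambda>\<omega>. a \<omega> - b \<omega>"
  let ?q = "\<lambda>\<omega>. c \<omega> + d \<omega>" and ?n = "\<lambda>\<omega>. c \<omega> - d \<omega>"
  have T: "?p \<in> S" "?m \<in> S" "?q \<in> S" "?n \<in> S"
    using S by (simp_all add: add diff)
  have "16 * expectation (\<lambda>\<omega>. a \<omega> * b \<omega> * c \<omega> * d \<omega>) = expectation (\<lambda>\<omega>. 16 * (a \<omega> * b \<omega> * c \<omega> * d \<omega>))"
    by simp
  also have "\<dots> = expectation (\<lambda>\<omega>. (?p \<omega>)\<^sup>2 * (?q \<omega>)\<^sup>2) - expectation (\<lambda>\<omega>. (?p \<omega>)\<^sup>2 * (?n \<omega>)\<^sup>2)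
      - expectation (\<lambda>\<omega>. (?m \<omega>)\<^sup>2 * (?q \<omega>)\<^sup>2) + expectation (\<lambda>\<omega>. (?m \<omega>)\<^sup>2 * (?n \<omega>)\<^sup>2)"
    unfolding id using i4[OF T(1) T(3)] i4[OF T(1) T(4)] i4[OF T(2) T(3)] i4[OF T(2) T(4)]
    by simp
  also have "\<dots> = 16 * (?E a b * ?E c d + ?E a c * ?E b d + ?E a d * ?E b c)"
  proof -
    have s: "expectation (\<lambda>\<omega>. (?p \<omega>)\<^sup>2) = ?E a a + 2 * ?E a b + ?E b b"
      "expectation (\<lambda>\<omega>. (?m \<omega>)\<^sup>2) = ?E a a - 2 * ?E a b + ?E b b"
      "expectation (\<lambda>\<omega>. (?q \<omega>)\<^sup>2) = ?E c c + 2 * ?E c d + ?E d d"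
      "expectation (\<lambda>\<omega>. (?n \<omega>)\<^sup>2) = ?E c c - 2 * ?E c d + ?E d d"
      unfolding sq using S by (simp_all add: i2)
    have m: "?E ?p ?q = ?E a c + ?E a d + ?E b c + ?E b d"
      "?E ?p ?n = ?E a c - ?E a d + ?E b c - ?E b d"
      "?E ?m ?q = ?E a c + ?E a d - ?E b c - ?E b d"
      "?E ?m ?n = ?E a c - ?E a d - ?E b c + ?E b d"
      unfolding pp using S by (simp_all add: i2)
    show ?thesis
      unfolding pair_squares[OF T(1) T(3)] pair_squares[OF T(1) T(4)] pair_squares[OF T(2) T(3)] pair_squares[OF T(2) T(4)] s m
      by algebra
  qed
  finally show ?thesis by (simp add: wick4_def)
qed

text \<open>
  The same polarization in degree three: \<open>X^2 Y\<close> is a combination of cubes, and \<open>4abc\<close> is a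
  difference of two products \<open>X^2 c\<close>.
\<close>
lemma triple:
  assumes S: "a \<in> S" "b \<in> S" "c \<in> S"
  shows "expectation (\<lambda>\<omega>. a \<omega> * b \<omega> * c \<omega>) = 0"
proof -
  have i3: "integrable M (\<lambda>\<omega>. x \<omega> * x \<omega> * y \<omega>)" if "x \<in> S" "y \<in> S" for x y
    using that by (intro L4_integrable_mult3 L4)
  have i33: "integrable M (\<lambda>\<omega>. x \<omega> ^ 3)" if "x \<in> S" for x
    using i3[OF that that] by (simp add: power3_eq_cube)
  have sq0: "expectation (\<lambda>\<omega>. x \<omega> * x \<omega> * y \<omega>) = 0" if xy: "x \<in> S" "y \<in> S" for x y
  proof -
    have id: "6 * (u * u * v) = (u + v) ^ 3 - (u - v) ^ 3 - 2 * v ^ 3" for u v :: real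
      by algebra
    have "6 * expectation (\<lambda>\<omega>. x \<omega> * x \<omega> * y \<omega>) = expectation (\<lambda>\<omega>. 6 * (x \<omega> * x \<omega> * y \<omega>))"
      by simp
    also have "\<dots> = 0"
      unfolding id using third[OF add[OF xy]] third[OF diff[OF xy]] third[OF xy(2)]
        i33[OF add[OF xy]] i33[OF diff[OF xy]] i33[OF xy(2)]
      by simp
    finally show ?thesis by simp
  qed
  have id: "4 * (u * v * w) = (u + v) * (u + v) * w - (u - v) * (u - v) * w" for u v w :: real
    by algebra
  have "4 * expectation (\<lambda>\<omega>. a \<omega> * b \<omega> * c \<omega>) = expectation (\<lambda>\<omega>. 4 * (a \<omega> * b \<omega> * c \<omega>))"
    by simp
  also have "\<dots> = 0"
    unfolding id using i3[OF add[OF S(1,2)] S(3)] i3[OF diff[OF S(1,2)] S(3)]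
      sq0[OF add[OF S(1,2)] S(3)] sq0[OF diff[OF S(1,2)] S(3)]
    by simp
  finally show ?thesis by simp
qed

end

section \<open>Moments of Gaussian processes\<close>

text \<open>
  In the nondegenerate case the moments are those of the normal density; an almost surely constant
  variable has all its central moments equal to zero.
\<close>
lemma (in prob_space) gaussian_variable_central_moments:
  assumes "gaussian_variable M Z"
  defines "m \<equiv> expectation Z"
  shows "integrable M Z" "L4 M (\<lambda>\<omega>. Z \<omega> - m)"
    "expectation (\<lambda>\<omega>. (Z \<omega> - m) ^ 3) = 0" "kurtosis3 M (\<lambda>\<omega>. Z \<omega> - m)"
proof -
  have meas[measurable]: "Z \<in> borel_measurable M"
    using assms by (simp add: gaussian_variable_def)
  consider \<mu> where "AE \<omega> in M. Z \<omega> = \<mu>"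
    | \<mu> \<sigma> where "0 < \<sigma>" "distributed M lborel Z (normal_density \<mu> \<sigma>)"
    using assms by (auto simp: gaussian_variable_def)
  then have "integrable M Z \<and> L4 M (\<lambda>\<omega>. Z \<omega> - m) \<and>
    expectation (\<lambda>\<omega>. (Z \<omega> - m) ^ 3) = 0 \<and> kurtosis3 M (\<lambda>\<omega>. Z \<omega> - m)"
  proof cases
    case 1
    have "m = expectation (\<lambda>_. \<mu>)"
      unfolding m_def using 1 by (intro integral_cong_AE) auto
    then have m: "m = \<mu>" by (simp add: prob_space)
    have "expectation (\<lambda>\<omega>. (Z \<omega> - m) ^ k) = expectation (\<lambda>_. 0)" if "0 < k" for k
      using 1 that by (intro integral_cong_AE) (auto simp: m)
    moreover have "integrable M Z \<longleftrightarrow> integrable M (\<lambda>_. \<mu>)"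
      using 1 by (intro integrable_cong_AE) auto
    moreover have "integrable M (\<lambda>\<omega>. (Z \<omega> - m) ^ 4) \<longleftrightarrow> integrable M (\<lambda>_. 0 :: real)"
      using 1 by (intro integrable_cong_AE) (auto simp: m)
    ultimately show ?thesis by (simp add: L4_def kurtosis3_def)
  next
    case 2
    have m: "m = \<mu>"
      unfolding m_def using 2 by (rule normal_distributed_expectation)
    have e: "expectation (\<lambda>\<omega>. (Z \<omega> - m) ^ k) = (\<integral>x. normal_density \<mu> \<sigma> x * (x - \<mu>) ^ k \<partial>lborel)" for k
      unfolding m using distributed_integral[OF 2(2), of "\<lambda>x. (x - \<mu>) ^ k"] by simp
    have i: "integrable M (\<lambda>\<omega>. (Z \<omega> - m) ^ k)" for k
      unfolding m using distributed_integrable[OF 2(2), of "\<lambda>x. (x - \<mu>) ^ k"]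
        integrable_normal_moment[OF 2(1), of \<mu> k] by simp
    have "integrable M (\<lambda>\<omega>. (Z \<omega> - m) ^ 1 + m)"
      using i[of 1] by (intro Bochner_Integration.integrable_add) auto
    moreover have "expectation (\<lambda>\<omega>. (Z \<omega> - m) ^ 3) = 0"
      using integral_normal_moment_odd[OF 2(1), of \<mu> 1] by (simp add: e)
    moreover have "kurtosis3 M (\<lambda>\<omega>. Z \<omega> - m)"
    proof -
      have "expectation (\<lambda>\<omega>. (Z \<omega> - m)\<^sup>2) = \<sigma>\<^sup>2"
        unfolding e using integral_normal_moment_even[OF 2(1), of \<mu> 1] by simp
      moreover have "expectation (\<lambda>\<omega>. (Z \<omega> - m) ^ 4) = 3 * (\<sigma>\<^sup>2)\<^sup>2"
        unfolding e using integral_normal_moment_even[OF 2(1), of \<mu> 2]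
        by (simp add: fact_numeral power_divide)
      ultimately show ?thesis by (simp add: kurtosis3_def)
    qed
    ultimately show ?thesis using i[of 4] by (simp add: L4_def)
  qed
  then show "integrable M Z" "L4 M (\<lambda>\<omega>. Z \<omega> - m)"
    "expectation (\<lambda>\<omega>. (Z \<omega> - m) ^ 3) = 0" "kurtosis3 M (\<lambda>\<omega>. Z \<omega> - m)" by auto
qed

lemma lin_comb_add:
  fixes \<Psi> :: "'t \<Rightarrow> 'a \<Rightarrow> real"
  assumes "finite T" "finite T'"
  shows "(\<Sum>t\<in>T. c t * \<Psi> t \<omega>) + k * (\<Sum>t\<in>T'. c' t * \<Psi> t \<omega>) =
    (\<Sum>t\<in>T \<union> T'. ((if t \<in> T then c t else 0) + k * (if t \<in> T' then c' t else 0)) * \<Psi> t \<omega>)"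
proof -
  have "(\<Sum>t\<in>T. c t * \<Psi> t \<omega>) = (\<Sum>t\<in>T \<union> T'. (if t \<in> T then c t else 0) * \<Psi> t \<omega>)"
    using assms by (intro sum.mono_neutral_cong_left) auto
  moreover have "(\<Sum>t\<in>T'. c' t * \<Psi> t \<omega>) = (\<Sum>t\<in>T \<union> T'. (if t \<in> T' then c' t else 0) * \<Psi> t \<omega>)"
    using assms by (intro sum.mono_neutral_cong_left) auto
  ultimately show ?thesis
    by (simp add: sum_distrib_left sum.distrib distrib_right mult.assoc)
qed

text \<open>
  The sums are over a set of distinct indices. This is the shape in which a Gaussian process
  provides normal variables; combinations with repeated indices come from closure under addition.
\<close>
definition lin_combs :: "('t \<Rightarrow> 'a \<Rightarrow> real) \<Rightarrow> ('a \<Rightarrow> real) set" where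
  "lin_combs \<Psi> = {Z. \<exists>T c. finite T \<and> Z = (\<lambda>\<omega>. \<Sum>t\<in>T. c t * \<Psi> t \<omega>)}"

lemma lin_combs_base: "\<Psi> t \<in> lin_combs \<Psi>"
  unfolding lin_combs_def by (intro CollectI exI[of _ "{t}"] exI[of _ "\<lambda>_. 1"]) auto

lemma lin_combs_combine:
  assumes "X \<in> lin_combs \<Psi>" "Y \<in> lin_combs \<Psi>"
  shows "(\<lambda>\<omega>. X \<omega> + k * Y \<omega>) \<in> lin_combs \<Psi>"
proof -
  obtain T c T' c' where "finite T" "finite T'" "X = (\<lambda>\<omega>. \<Sum>t\<in>T. c t * \<Psi> t \<omega>)" "Y = (\<lambda>\<omega>. \<Sum>t\<in>T'. c' t * \<Psi> t \<omega>)"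
    using assms unfolding lin_combs_def by blast
  moreover from this have "(\<lambda>\<omega>. X \<omega> + k * Y \<omega>) = (\<lambda>\<omega>. \<Sum>t\<in>T \<union> T'.
      ((if t \<in> T then c t else 0) + k * (if t \<in> T' then c' t else 0)) * \<Psi> t \<omega>)"
    by (simp only: lin_comb_add)
  ultimately show ?thesis
    unfolding lin_combs_def by (intro CollectI exI[of _ "T \<union> T'"] exI conjI) auto
qed

lemma (in prob_space) gaussian_process_component:
  assumes "gaussian_process M \<Phi>"
  shows "gaussian_variable M (\<Phi> t)"
  using assms[unfolded gaussian_process_def, rule_format, of "{t}" "\<lambda>_. 1"] by simp

lemma (in prob_space) centred_gaussian_process_moments:
  assumes "gaussian_process M \<Phi>"
  shows "gaussian_moment_space M (lin_combs (\<lambda>t \<omega>. \<Phi> t \<omega> - expectation (\<Phi> t)))"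
proof -
  let ?\<Psi> = "\<lambda>t \<omega>. \<Phi> t \<omega> - expectation (\<Phi> t)"
  have int: "integrable M (\<Phi> t)" for t
    using gaussian_variable_central_moments(1)[OF gaussian_process_component[OF assms]] .
  have *: "L4 M Z \<and> expectation (\<lambda>\<omega>. Z \<omega> ^ 3) = 0 \<and> kurtosis3 M Z" if "Z \<in> lin_combs ?\<Psi>" for Z
  proof -
    from that obtain T c where T: "finite T" "Z = (\<lambda>\<omega>. \<Sum>t\<in>T. c t * ?\<Psi> t \<omega>)"
      by (auto simp: lin_combs_def)
    let ?Y = "\<lambda>\<omega>. \<Sum>t\<in>T. c t * \<Phi> t \<omega>"
    have G: "gaussian_variable M ?Y"
      using assms T(1) by (simp add: gaussian_process_def)
    have "Z = (\<lambda>\<omega>. ?Y \<omega> - expectation ?Y)"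
      using int by (simp add: T(2) right_diff_distrib sum_subtractf)
    then show ?thesis
      using gaussian_variable_central_moments[OF G] by simp
  qed
  show ?thesis
  proof
    fix X Y assume XY: "X \<in> lin_combs ?\<Psi>" "Y \<in> lin_combs ?\<Psi>"
    show "(\<lambda>\<omega>. X \<omega> + Y \<omega>) \<in> lin_combs ?\<Psi>" "(\<lambda>\<omega>. X \<omega> - Y \<omega>) \<in> lin_combs ?\<Psi>"
      using lin_combs_combine[OF XY, of 1] lin_combs_combine[OF XY, of "-1"] by simp_all
  qed (use * in auto)
qed

section \<open>Integrals of a random field against a weight\<close>

text \<open>
  Jensen's inequality for the fourth power and the measure \<open>g N\<close>, by applying Cauchy-Schwarz twice.
\<close>
lemma nn_integral_power4_le:
  assumes [measurable]: "g \<in> borel_measurable N" "u \<in> borel_measurable N"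
  shows "(\<integral>\<^sup>+t. g t * u t \<partial>N) ^ 4 \<le> (\<integral>\<^sup>+t. g t \<partial>N) ^ 3 * (\<integral>\<^sup>+t. g t * u t ^ 4 \<partial>N)"
proof -
  have cs: "(\<integral>\<^sup>+t. g t * v t \<partial>N)\<^sup>2 \<le> (\<integral>\<^sup>+t. g t \<partial>N) * (\<integral>\<^sup>+t. g t * (v t)\<^sup>2 \<partial>N)"
    if [measurable]: "v \<in> borel_measurable N" for v
    using Cauchy_Schwarz_nn_integral[of "\<lambda>_. 1" "density N g" v]
    by (simp add: nn_integral_density emeasure_density power2_eq_square)
  have "(\<integral>\<^sup>+t. g t * u t \<partial>N) ^ 4 = ((\<integral>\<^sup>+t. g t * u t \<partial>N)\<^sup>2)\<^sup>2"
    by simp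
  also have "\<dots> \<le> ((\<integral>\<^sup>+t. g t \<partial>N) * (\<integral>\<^sup>+t. g t * (u t)\<^sup>2 \<partial>N))\<^sup>2"
    by (intro power_mono cs) auto
  also have "\<dots> = (\<integral>\<^sup>+t. g t \<partial>N)\<^sup>2 * (\<integral>\<^sup>+t. g t * (u t)\<^sup>2 \<partial>N)\<^sup>2"
    by (simp add: power_mult_distrib)
  also have "\<dots> \<le> (\<integral>\<^sup>+t. g t \<partial>N)\<^sup>2 * ((\<integral>\<^sup>+t. g t \<partial>N) * (\<integral>\<^sup>+t. g t * ((u t)\<^sup>2)\<^sup>2 \<partial>N))"
    by (intro mult_left_mono cs) auto
  also have "\<dots> = (\<integral>\<^sup>+t. g t \<partial>N) ^ 3 * (\<integral>\<^sup>+t. g t * u t ^ 4 \<partial>N)"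
    by (simp add: power2_eq_square power3_eq_cube power4_eq_xxxx mult.assoc)
  finally show ?thesis .
qed

definition smear :: "'t measure \<Rightarrow> ('t \<Rightarrow> 'a \<Rightarrow> real) \<Rightarrow> ('t \<Rightarrow> real) \<Rightarrow> 'a \<Rightarrow> real" where
  "smear N \<Psi> h \<omega> = (\<integral>t. h t * \<Psi> t \<omega> \<partial>N)"

text \<open>
  The uniform bound on the fourth moments makes every integrable weight \<open>h\<close> admissible for
  integrating the field against.
\<close>
locale L4_field = prob_space M + index: sigma_finite_measure N
  for M :: "'a measure" and N :: "'t measure" +
  fixes \<Psi> :: "'t \<Rightarrow> 'a \<Rightarrow> real" and K :: real
  assumes joint: "(\<lambda>(t, \<omega>). \<Psi> t \<omega>) \<in> borel_measurable (N \<Otimes>\<^sub>M M)"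
    and L4_field: "L4 M (\<Psi> t)"
    and bound: "expectation (\<lambda>\<omega>. \<Psi> t \<omega> ^ 4) \<le> K"
begin

sublocale pair_sigma_finite N M ..

lemma joint_swapped: "(\<lambda>(\<omega>, t). \<Psi> t \<omega>) \<in> borel_measurable (M \<Otimes>\<^sub>M N)"
  using measurable_compose[OF measurable_pair_swap' joint] by (simp add: case_prod_unfold)

lemma smear_measurable:
  assumes [measurable]: "h \<in> borel_measurable N"
  shows "smear N \<Psi> h \<in> borel_measurable M"
proof -
  note joint_swapped[measurable]
  have "(\<lambda>\<omega>. \<integral>t. h t * \<Psi> t \<omega> \<partial>N) \<in> borel_measurable M"
    by (rule index.borel_measurable_lebesgue_integral) measurable
  then show ?thesis by (simp add: smear_def[abs_def])
qed

text \<open>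
  Smearing is linear, so it moves one factor of a mixed moment at a time from the smeared field to the
  field itself. The other three factors are arbitrary \<open>L4\<close> variables: some of them may already be
  smeared, and taking some of them constant \<open>1\<close> gives the moments of lower order.
\<close>
lemma smear_fubini:
  assumes h: "integrable N h" and Z: "L4 M a" "L4 M b" "L4 M c"
  shows "AE \<omega> in M. integrable N (\<lambda>t. h t * \<Psi> t \<omega>)"
    and "expectation (\<lambda>\<omega>. smear N \<Psi> h \<omega> * a \<omega> * b \<omega> * c \<omega>) =
      (\<integral>t. h t * expectation (\<lambda>\<omega>. \<Psi> t \<omega> * a \<omega> * b \<omega> * c \<omega>) \<partial>N)"
    and "integrable N (\<lambda>t. h t * expectation (\<lambda>\<omega>. \<Psi> t \<omega> * a \<omega> * b \<omega> * c \<omega>))"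
proof -
  note joint[measurable] Z[THEN L4_measurable, measurable]
  have [measurable]: "h \<in> borel_measurable N" using h by simp
  have int: "integrable (N \<Otimes>\<^sub>M M) (\<lambda>(t, \<omega>). h t * (\<Psi> t \<omega> * a \<omega> * b \<omega> * c \<omega>))"
    if Z: "L4 M a" "L4 M b" "L4 M c" for a b c
  proof (rule Fubini_integrable)
    note Z[THEN L4_measurable, measurable]
    show meas: "(\<lambda>(t, \<omega>). h t * (\<Psi> t \<omega> * a \<omega> * b \<omega> * c \<omega>)) \<in> borel_measurable (N \<Otimes>\<^sub>M M)"
      by measurable
    have i: "integrable M (\<lambda>\<omega>. \<Psi> t \<omega> * a \<omega> * b \<omega> * c \<omega>)" for t
      by (intro L4_integrable_mult4 L4_field Z)
    \<comment> \<open>a bound on the absolute mixed moments that is uniform in \<open>t\<close>\<close>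
    define B where "B = K + expectation (\<lambda>\<omega>. a \<omega> ^ 4) + expectation (\<lambda>\<omega>. b \<omega> ^ 4) + expectation (\<lambda>\<omega>. c \<omega> ^ 4)"
    have "expectation (\<lambda>\<omega>. \<bar>\<Psi> t \<omega> * a \<omega> * b \<omega> * c \<omega>\<bar>) \<le> B" for t
    proof -
      have i4: "integrable M (\<lambda>\<omega>. \<Psi> t \<omega> ^ 4)" "integrable M (\<lambda>\<omega>. a \<omega> ^ 4)"
        "integrable M (\<lambda>\<omega>. b \<omega> ^ 4)" "integrable M (\<lambda>\<omega>. c \<omega> ^ 4)"
        using L4_field Z by (simp_all add: L4_def)
      have "expectation (\<lambda>\<omega>. \<bar>\<Psi> t \<omega> * a \<omega> * b \<omega> * c \<omega>\<bar>) \<le>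
        expectation (\<lambda>\<omega>. \<Psi> t \<omega> ^ 4 + a \<omega> ^ 4 + b \<omega> ^ 4 + c \<omega> ^ 4)"
        using i[of t] i4 by (intro integral_mono abs_mult4_le) auto
      also have "\<dots> \<le> B"
        using i4 bound[of t] by (simp add: B_def)
      finally show ?thesis .
    qed
    then have le: "norm (\<integral>\<omega>. norm (h t * (\<Psi> t \<omega> * a \<omega> * b \<omega> * c \<omega>)) \<partial>M) \<le> norm (h t * B)" for t
      unfolding norm_mult real_norm_def
      by (simp add: abs_mult[of "h t"] mult_left_mono order_trans[OF _ abs_ge_self])
    show "integrable N (\<lambda>t. \<integral>\<omega>. norm (case (t, \<omega>) of (t, \<omega>) \<Rightarrow> h t * (\<Psi> t \<omega> * a \<omega> * b \<omega> * c \<omega>)) \<partial>M)"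
    proof (rule Bochner_Integration.integrable_bound)
      show "integrable N (\<lambda>t. h t * B)" using h by simp
      show "(\<lambda>t. \<integral>\<omega>. norm (case (t, \<omega>) of (t, \<omega>) \<Rightarrow> h t * (\<Psi> t \<omega> * a \<omega> * b \<omega> * c \<omega>)) \<partial>M) \<in> borel_measurable N"
        using meas by measurable
    qed (use le in auto)
    show "AE t in N. integrable M (\<lambda>\<omega>. case (t, \<omega>) of (t, \<omega>) \<Rightarrow> h t * (\<Psi> t \<omega> * a \<omega> * b \<omega> * c \<omega>))"
      using i by simp
  qed
  show "AE \<omega> in M. integrable N (\<lambda>t. h t * \<Psi> t \<omega>)"
    using AE_integrable_snd[OF int[OF L4_one L4_one L4_one]] by simp
  show "integrable N (\<lambda>t. h t * expectation (\<lambda>\<omega>. \<Psi> t \<omega> * a \<omega> * b \<omega> * c \<omega>))"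
    using integrable_fst[OF int[OF Z]] by simp
  have "smear N \<Psi> h \<omega> * a \<omega> * b \<omega> * c \<omega> = (\<integral>t. h t * \<Psi> t \<omega> * (a \<omega> * b \<omega> * c \<omega>) \<partial>N)" for \<omega>
    unfolding smear_def integral_mult_left_zero by (simp only: mult.assoc)
  then have "expectation (\<lambda>\<omega>. smear N \<Psi> h \<omega> * a \<omega> * b \<omega> * c \<omega>) =
      (\<integral>\<omega>. (\<integral>t. h t * (\<Psi> t \<omega> * a \<omega> * b \<omega> * c \<omega>) \<partial>N) \<partial>M)"
    by (simp only: mult.assoc)
  also have "\<dots> = (\<integral>t. (\<integral>\<omega>. h t * (\<Psi> t \<omega> * a \<omega> * b \<omega> * c \<omega>) \<partial>M) \<partial>N)"
    by (rule Fubini_integral[OF int[OF Z]])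
  finally show "expectation (\<lambda>\<omega>. smear N \<Psi> h \<omega> * a \<omega> * b \<omega> * c \<omega>) =
      (\<integral>t. h t * expectation (\<lambda>\<omega>. \<Psi> t \<omega> * a \<omega> * b \<omega> * c \<omega>) \<partial>N)"
    by simp
qed

text \<open>
  Pathwise, Jensen's inequality bounds \<open>\<bar>\<integral> h \<Psi>\<bar>^4\<close> by a constant times \<open>\<integral> \<bar>h\<bar> \<Psi>^4\<close>, whose expectation is finite by
  Tonelli's theorem and the uniform bound.
\<close>
lemma L4_smear:
  assumes h: "integrable N h"
  shows "L4 M (smear N \<Psi> h)"
proof -
  note joint[measurable] joint_swapped[measurable]
  have [measurable]: "h \<in> borel_measurable N" using h by simp
  note smear_measurable[of h, measurable]
  have "(\<integral>\<^sup>+t. norm (h t) \<partial>N) < \<infinity>"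
    using h by (simp add: integrable_iff_bounded)
  have "(\<integral>\<^sup>+\<omega>. norm (smear N \<Psi> h \<omega> ^ 4) \<partial>M) \<le>
    (\<integral>\<^sup>+\<omega>. (\<integral>\<^sup>+t. norm (h t) \<partial>N) ^ 3 * (\<integral>\<^sup>+t. ennreal (norm (h t)) * ennreal \<bar>\<Psi> t \<omega>\<bar> ^ 4 \<partial>N) \<partial>M)"
  proof (rule nn_integral_mono_AE, use smear_fubini(1)[OF h L4_one L4_one L4_one] AE_space in eventually_elim)
    fix \<omega> assume i: "integrable N (\<lambda>t. h t * \<Psi> t \<omega>)" and [measurable]: "\<omega> \<in> space M"
    have [measurable]: "(\<lambda>t. \<Psi> t \<omega>) \<in> borel_measurable N"
      using measurable_compose[OF measurable_Pair1'[of \<omega> M N] joint_swapped] by simp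
    have "ennreal (norm (smear N \<Psi> h \<omega>)) \<le> (\<integral>\<^sup>+t. norm (h t * \<Psi> t \<omega>) \<partial>N)"
      unfolding smear_def by (rule integral_norm_bound_ennreal[OF i])
    also have "\<dots> = (\<integral>\<^sup>+t. ennreal (norm (h t)) * ennreal \<bar>\<Psi> t \<omega>\<bar> \<partial>N)"
      by (simp add: abs_mult ennreal_mult)
    finally have "ennreal (norm (smear N \<Psi> h \<omega>)) ^ 4 \<le> (\<integral>\<^sup>+t. ennreal (norm (h t)) * ennreal \<bar>\<Psi> t \<omega>\<bar> \<partial>N) ^ 4"
      by (rule power_mono) simp
    also have "\<dots> \<le> (\<integral>\<^sup>+t. norm (h t) \<partial>N) ^ 3 * (\<integral>\<^sup>+t. ennreal (norm (h t)) * ennreal \<bar>\<Psi> t \<omega>\<bar> ^ 4 \<partial>N)"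
      by (rule nn_integral_power4_le) measurable
    finally show "ennreal (norm (smear N \<Psi> h \<omega> ^ 4)) \<le>
        (\<integral>\<^sup>+t. norm (h t) \<partial>N) ^ 3 * (\<integral>\<^sup>+t. ennreal (norm (h t)) * ennreal \<bar>\<Psi> t \<omega>\<bar> ^ 4 \<partial>N)"
      by (simp add: ennreal_power norm_power)
  qed
  also have "\<dots> = (\<integral>\<^sup>+t. norm (h t) \<partial>N) ^ 3 *
     (\<integral>\<^sup>+\<omega>. (\<integral>\<^sup>+t. ennreal (norm (h t)) * ennreal \<bar>\<Psi> t \<omega>\<bar> ^ 4 \<partial>N) \<partial>M)"
    by (rule nn_integral_cmult) measurable
  also have "(\<integral>\<^sup>+\<omega>. (\<integral>\<^sup>+t. ennreal (norm (h t)) * ennreal \<bar>\<Psi> t \<omega>\<bar> ^ 4 \<partial>N) \<partial>M) =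
     (\<integral>\<^sup>+t. (\<integral>\<^sup>+\<omega>. ennreal (norm (h t)) * ennreal \<bar>\<Psi> t \<omega>\<bar> ^ 4 \<partial>M) \<partial>N)"
    by (rule Fubini') measurable
  also have "\<dots> \<le> (\<integral>\<^sup>+t. ennreal (norm (h t)) * ennreal K \<partial>N)"
  proof (rule nn_integral_mono)
    fix t
    have [measurable]: "\<Psi> t \<in> borel_measurable M" by (intro L4_measurable L4_field)
    have i: "integrable M (\<lambda>\<omega>. \<Psi> t \<omega> ^ 4)" using L4_field by (simp add: L4_def)
    have "(\<integral>\<^sup>+\<omega>. ennreal (norm (h t)) * ennreal \<bar>\<Psi> t \<omega>\<bar> ^ 4 \<partial>M) =
        ennreal (norm (h t)) * (\<integral>\<^sup>+\<omega>. ennreal (\<Psi> t \<omega> ^ 4) \<partial>M)"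
      by (simp add: nn_integral_cmult ennreal_power)
    also have "(\<integral>\<^sup>+\<omega>. ennreal (\<Psi> t \<omega> ^ 4) \<partial>M) = ennreal (expectation (\<lambda>\<omega>. \<Psi> t \<omega> ^ 4))"
      by (rule nn_integral_eq_integral[OF i]) auto
    also have "\<dots> \<le> ennreal K" using bound by (rule ennreal_leI)
    finally show "(\<integral>\<^sup>+\<omega>. ennreal (norm (h t)) * ennreal \<bar>\<Psi> t \<omega>\<bar> ^ 4 \<partial>M) \<le> ennreal (norm (h t)) * ennreal K"
      by (simp add: mult_left_mono)
  qed
  also have "\<dots> = (\<integral>\<^sup>+t. norm (h t) \<partial>N) * ennreal K"
    by (rule nn_integral_multc) measurable
  finally have "(\<integral>\<^sup>+\<omega>. norm (smear N \<Psi> h \<omega> ^ 4) \<partial>M) \<le>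
      (\<integral>\<^sup>+t. norm (h t) \<partial>N) ^ 3 * ((\<integral>\<^sup>+t. norm (h t) \<partial>N) * ennreal K)"
    by (simp add: mult_left_mono)
  also have "\<dots> < \<infinity>"
    using \<open>(\<integral>\<^sup>+t. norm (h t) \<partial>N) < \<infinity>\<close>
    by (simp add: ennreal_mult_less_top power_less_top_ennreal)
  finally have "integrable M (\<lambda>\<omega>. smear N \<Psi> h \<omega> ^ 4)"
    by (simp add: integrable_iff_bounded)
  then show ?thesis by (simp add: L4_def)
qed

lemma smear_fubini2:
  assumes "integrable N h" "L4 M a"
  shows "expectation (\<lambda>\<omega>. smear N \<Psi> h \<omega> * a \<omega>) = (\<integral>t. h t * expectation (\<lambda>\<omega>. \<Psi> t \<omega> * a \<omega>) \<partial>N)"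
    and "integrable N (\<lambda>t. h t * expectation (\<lambda>\<omega>. \<Psi> t \<omega> * a \<omega>))"
  using smear_fubini(2,3)[OF assms L4_one L4_one] by simp_all

text \<open>
  Both sides of the formula are linear in the first factor, so it survives integration against \<open>h\<close>.
\<close>
lemma wick4_smear:
  assumes h: "integrable N h" and Z: "L4 M a" "L4 M b" "L4 M c"
    and W: "\<And>t. wick4 M (\<Psi> t) a b c"
  shows "wick4 M (smear N \<Psi> h) a b c"
proof -
  let ?E = "\<lambda>x y. expectation (\<lambda>\<omega>. x \<omega> * y \<omega>)"
  note f = smear_fubini2[OF h Z(1)] smear_fubini2[OF h Z(2)] smear_fubini2[OF h Z(3)]
  have "expectation (\<lambda>\<omega>. smear N \<Psi> h \<omega> * a \<omega> * b \<omega> * c \<omega>) =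
    (\<integral>t. h t * (?E (\<Psi> t) a * ?E b c + ?E (\<Psi> t) b * ?E a c + ?E (\<Psi> t) c * ?E a b) \<partial>N)"
    using W smear_fubini(2)[OF h Z] by (simp add: wick4_def)
  also have "\<dots> = (\<integral>t. h t * ?E (\<Psi> t) a * ?E b c + h t * ?E (\<Psi> t) b * ?E a c + h t * ?E (\<Psi> t) c * ?E a b \<partial>N)"
    by (simp add: distrib_left mult.assoc)
  also have "\<dots> = ?E (smear N \<Psi> h) a * ?E b c + ?E (smear N \<Psi> h) b * ?E a c + ?E (smear N \<Psi> h) c * ?E a b"
    using f by simp
  finally show ?thesis by (simp add: wick4_def)
qed

lemma triple_smear:
  assumes h: "integrable N h" and Z: "L4 M a" "L4 M b"
    and W: "\<And>t. expectation (\<lambda>\<omega>. \<Psi> t \<omega> * a \<omega> * b \<omega>) = 0"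
  shows "expectation (\<lambda>\<omega>. smear N \<Psi> h \<omega> * a \<omega> * b \<omega>) = 0"
  using smear_fubini(2)[OF h Z L4_one] by (simp add: W)

lemma mean_smear:
  assumes h: "integrable N h" and W: "\<And>t. expectation (\<Psi> t) = 0"
  shows "expectation (smear N \<Psi> h) = 0"
  using smear_fubini(2)[OF h L4_one L4_one L4_one] by (simp add: W)

end

section \<open>Moments of smeared Gaussian fields\<close>

lemma wick4_rotate: "wick4 M a b c d \<Longrightarrow> wick4 M b c d a"
  by (simp add: wick4_def ac_simps)

text \<open>
  A centred field whose finite linear combinations have Gaussian moments. The smeared variables
  lie in general outside \<open>lin_combs\<close>; Fubini's theorem carries the moment formulas over to them.
\<close>
locale gaussian_field = L4_field M N \<Psi> K + gaussian_moment_space M "lin_combs \<Psi>"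
  for M :: "'a measure" and N :: "'t measure" and \<Psi> K +
  assumes centred: "expectation (\<Psi> t) = 0"
begin

text \<open>
  The four factors \<open>\<Psi> s\<close>, \<open>\<Psi> t\<close>, \<open>\<Psi> u\<close>, \<open>\<Psi> v\<close> are replaced in turn by smeared variables; the rotation
  brings the next unsmeared factor to the front.
\<close>
lemma wick_smear:
  assumes "integrable N h" "integrable N k"
  shows "expectation (\<lambda>\<omega>. (smear N \<Psi> h \<omega>)\<^sup>2 * (smear N \<Psi> k \<omega>)\<^sup>2) =
    expectation (\<lambda>\<omega>. (smear N \<Psi> h \<omega>)\<^sup>2) * expectation (\<lambda>\<omega>. (smear N \<Psi> k \<omega>)\<^sup>2) +
    2 * (expectation (\<lambda>\<omega>. smear N \<Psi> h \<omega> * smear N \<Psi> k \<omega>))\<^sup>2"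
proof -
  let ?X = "smear N \<Psi> h" and ?Y = "smear N \<Psi> k"
  note L = L4_field L4_smear[OF assms(1)] L4_smear[OF assms(2)]
  have 0: "wick4 M (\<Psi> s) (\<Psi> t) (\<Psi> u) (\<Psi> v)" for s t u v
    by (intro wick lin_combs_base)
  have 1: "wick4 M (\<Psi> t) (\<Psi> u) (\<Psi> v) ?X" for t u v
    by (rule wick4_rotate, rule wick4_smear) (intro assms L 0)+
  have 2: "wick4 M (\<Psi> u) (\<Psi> v) ?X ?X" for u v
    by (rule wick4_rotate, rule wick4_smear) (intro assms L 1)+
  have 3: "wick4 M (\<Psi> v) ?X ?X ?Y" for v
    by (rule wick4_rotate, rule wick4_smear) (intro assms L 2)+
  have "wick4 M ?X ?X ?Y ?Y"
    by (rule wick4_rotate, rule wick4_smear) (intro assms L 3)+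
  then show ?thesis
    by (simp add: wick4_def power2_eq_square ac_simps)
qed

lemma triple_zero_smear:
  assumes "integrable N h" "integrable N k"
  shows "expectation (\<lambda>\<omega>. smear N \<Psi> h \<omega> * (smear N \<Psi> k \<omega>)\<^sup>2) = 0"
proof -
  let ?X = "smear N \<Psi> h" and ?Y = "smear N \<Psi> k"
  note L = L4_field L4_smear[OF assms(1)] L4_smear[OF assms(2)]
  have 0: "expectation (\<lambda>\<omega>. \<Psi> t \<omega> * \<Psi> u \<omega> * \<Psi> v \<omega>) = 0" for t u v
    by (intro triple lin_combs_base)
  have 1: "expectation (\<lambda>\<omega>. \<Psi> u \<omega> * \<Psi> v \<omega> * ?X \<omega>) = 0" for u v
    using triple_smear[OF assms(1) L(1,1) 0, of u v] by (simp add: ac_simps)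
  have 2: "expectation (\<lambda>\<omega>. \<Psi> v \<omega> * ?X \<omega> * ?Y \<omega>) = 0" for v
    using triple_smear[OF assms(2) L(1,2) 1, of v] by (simp add: ac_simps)
  show ?thesis
    using triple_smear[OF assms(2) L(2,3) 2] by (simp add: ac_simps power2_eq_square)
qed

text \<open>
  In the expanded product all terms of odd degree in \<open>X\<close> and \<open>Y\<close> vanish; \<open>4ab XY\<close> gives the first
  term, and the pairings in \<open>X^2 Y^2\<close> that mix \<open>X\<close> with \<open>Y\<close> give the second.
\<close>
lemma covariance_shifted_squares:
  fixes a b :: real
  assumes h: "integrable N h" and k: "integrable N k"
  shows "covariance M (\<lambda>\<omega>. (a + smear N \<Psi> h \<omega>)\<^sup>2) (\<lambda>\<omega>. (b + smear N \<Psi> k \<omega>)\<^sup>2) =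
    4 * a * b * expectation (\<lambda>\<omega>. smear N \<Psi> h \<omega> * smear N \<Psi> k \<omega>) +
    2 * (expectation (\<lambda>\<omega>. smear N \<Psi> h \<omega> * smear N \<Psi> k \<omega>))\<^sup>2"
proof -
  define X Y where "X = smear N \<Psi> h" and "Y = smear N \<Psi> k"
  note L = L4_smear[OF h, folded X_def] L4_smear[OF k, folded Y_def]
  define A B where "A = expectation (\<lambda>\<omega>. (X \<omega>)\<^sup>2)" and "B = expectation (\<lambda>\<omega>. (Y \<omega>)\<^sup>2)"
  have i: "integrable M X" "integrable M Y" "integrable M (\<lambda>\<omega>. X \<omega> * Y \<omega>)"
    "integrable M (\<lambda>\<omega>. (X \<omega>)\<^sup>2)" "integrable M (\<lambda>\<omega>. (Y \<omega>)\<^sup>2)"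
    "integrable M (\<lambda>\<omega>. X \<omega> * (Y \<omega>)\<^sup>2)" "integrable M (\<lambda>\<omega>. Y \<omega> * (X \<omega>)\<^sup>2)"
    "integrable M (\<lambda>\<omega>. (X \<omega>)\<^sup>2 * (Y \<omega>)\<^sup>2)"
    using L4_integrable[OF L(1)] L4_integrable[OF L(2)] L4_integrable_mult2[OF L]
      L4_integrable_mult2[OF L(1,1)] L4_integrable_mult2[OF L(2,2)]
      L4_integrable_mult3[OF L(1,2,2)] L4_integrable_mult3[OF L(2,1,1)] L4_integrable_mult4[OF L(1,1,2,2)]
    by (simp_all add: power2_eq_square mult.assoc)
  have e: "expectation X = 0" "expectation Y = 0"
    "expectation (\<lambda>\<omega>. X \<omega> * (Y \<omega>)\<^sup>2) = 0" "expectation (\<lambda>\<omega>. Y \<omega> * (X \<omega>)\<^sup>2) = 0"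
    "expectation (\<lambda>\<omega>. (X \<omega>)\<^sup>2 * (Y \<omega>)\<^sup>2) = A * B + 2 * (expectation (\<lambda>\<omega>. X \<omega> * Y \<omega>))\<^sup>2"
    unfolding X_def Y_def A_def B_def
    by (intro mean_smear centred triple_zero_smear wick_smear h k)+
  have m: "expectation (\<lambda>\<omega>. (a + X \<omega>)\<^sup>2) = a\<^sup>2 + A" "expectation (\<lambda>\<omega>. (b + Y \<omega>)\<^sup>2) = b\<^sup>2 + B"
    using i e by (simp_all add: power2_sum A_def B_def prob_space mult.assoc)
  have id: "((a + x)\<^sup>2 - (a\<^sup>2 + A)) * ((b + y)\<^sup>2 - (b\<^sup>2 + B)) =
     4 * a * b * (x * y) + 2 * a * (x * y\<^sup>2) - 2 * a * B * x + 2 * b * (y * x\<^sup>2) - 2 * b * A * y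
      + x\<^sup>2 * y\<^sup>2 - B * x\<^sup>2 - A * y\<^sup>2 + A * B" for x y
    by algebra
  show ?thesis
    unfolding covariance_def X_def[symmetric] Y_def[symmetric] m id
    using i e by (simp add: prob_space flip: A_def B_def)
qed

end

section \<open>Spectral representation\<close>
lemma sigma_finite_lebesgue: "sigma_finite_measure (lebesgue :: 'a::euclidean_space measure)"
proof
  obtain A :: "'a set set" where A: "countable A" "A \<subseteq> sets lborel" "\<Union>A = space lborel" "\<forall>a\<in>A. emeasure lborel a \<noteq> \<infinity>"
    using lborel.sigma_finite_countable by blast
  show "\<exists>A::'a set set. countable A \<and> A \<subseteq> sets lebesgue \<and> \<Union>A = space lebesgue \<and> (\<forall>a\<in>A. emeasure lebesgue a \<noteq> \<infinity>)"
    using A by (intro exI[of _ A]) (auto simp: subset_iff)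
qed

lemma lebesgue_fst_measurable: "(\<lambda>p. fst p :: real) \<in> borel_measurable (lebesgue \<Otimes>\<^sub>M F)"
proof -
  have "(\<lambda>x::real. x) \<in> borel_measurable lebesgue"
    by (intro measurable_completion) simp
  from measurable_compose[OF measurable_fst this] show ?thesis .
qed

text \<open>
  The one exchange of integrals behind the spectral representation. The factor \<open>b\<close> is a place for
  what does not depend on \<open>t\<close>, and the sign \<open>e\<close> covers both a Fourier transform and its conjugate.
\<close>
lemma iexp_fubini:
  fixes g :: "real \<Rightarrow> real" and b :: "real \<Rightarrow> complex" and e B :: real
  assumes g: "integrable lebesgue g" and F: "finite_measure F" "sets F = sets borel"
    and b: "b \<in> borel_measurable F" "\<And>x. cmod (b x) \<le> B"
  shows "(CLINT t|lebesgue. complex_of_real (g t) * (CLINT x|F. iexp (e * t * x) * b x)) =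
    (CLINT x|F. (CLINT t|lebesgue. iexp (e * t * x) * complex_of_real (g t)) * b x)"
proof -
  interpret F: finite_measure F by fact
  interpret L: sigma_finite_measure "lebesgue :: real measure" by (rule sigma_finite_lebesgue)
  interpret P: pair_sigma_finite "lebesgue :: real measure" F ..
  have [measurable]: "g \<in> borel_measurable lebesgue" using g by simp
  note b(1)[measurable] lebesgue_fst_measurable[measurable]
  have idF[measurable]: "(\<lambda>x. x) \<in> borel_measurable F"
    using F(2) by (simp add: measurable_def sets_eq_imp_space_eq[OF F(2)])
  have [measurable]: "(\<lambda>p. snd p :: real) \<in> borel_measurable (lebesgue \<Otimes>\<^sub>M F)"
    using measurable_compose[OF measurable_snd idF] .
  have nb: "cmod (complex_of_real (g t) * (iexp (e * t * x) * b x)) \<le> \<bar>g t\<bar> * B" for t x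
    using b(2)[of x] by (simp add: norm_mult mult_left_mono)
  have "integrable (lebesgue \<Otimes>\<^sub>M F) (\<lambda>(t, x). complex_of_real (g t) * (iexp (e * t * x) * b x))"
  proof (rule P.Fubini_integrable)
    have "(\<lambda>p. complex_of_real (g (fst p)) * (iexp (e * fst p * snd p) * b (snd p)))
        \<in> borel_measurable (lebesgue \<Otimes>\<^sub>M F)"
      by measurable
    then show meas: "(\<lambda>(t, x). complex_of_real (g t) * (iexp (e * t * x) * b x))
        \<in> borel_measurable (lebesgue \<Otimes>\<^sub>M F)"
      by (simp add: case_prod_unfold)
    have i: "integrable F (\<lambda>x. complex_of_real (g t) * (iexp (e * t * x) * b x))" for t
      using nb[of t] by (intro F.integrable_const_bound[where B = "\<bar>g t\<bar> * B"]) auto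
    show "AE t in lebesgue. integrable F (\<lambda>x. case (t, x) of (t, x) \<Rightarrow> complex_of_real (g t) * (iexp (e * t * x) * b x))"
      using i by simp
    show "integrable lebesgue (\<lambda>t. \<integral>x. norm (case (t, x) of (t, x) \<Rightarrow> complex_of_real (g t) * (iexp (e * t * x) * b x)) \<partial>F)"
    proof (rule Bochner_Integration.integrable_bound)
      show "integrable lebesgue (\<lambda>t. \<bar>g t\<bar> * B * measure F (space F))" using g by simp
      show "(\<lambda>t. \<integral>x. norm (case (t, x) of (t, x) \<Rightarrow> complex_of_real (g t) * (iexp (e * t * x) * b x)) \<partial>F) \<in> borel_measurable lebesgue"
        using meas by measurable
      have bd: "(\<integral>x. norm (complex_of_real (g t) * (iexp (e * t * x) * b x)) \<partial>F)
          \<le> \<bar>g t\<bar> * B * measure F (space F)" for t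
      proof -
        have "(\<integral>x. norm (complex_of_real (g t) * (iexp (e * t * x) * b x)) \<partial>F) \<le> (\<integral>x. \<bar>g t\<bar> * B \<partial>F)"
          using i[of t] nb[of t] by (intro integral_mono) auto
        also have "\<dots> = \<bar>g t\<bar> * B * measure F (space F)"
          by (simp only: lebesgue_integral_const real_scaleR_def mult.commute)
        finally show ?thesis .
      qed
      show "AE t in lebesgue. norm (\<integral>x. norm (case (t, x) of (t, x) \<Rightarrow> complex_of_real (g t) * (iexp (e * t * x) * b x)) \<partial>F)
          \<le> norm (\<bar>g t\<bar> * B * measure F (space F))"
        using order_trans[OF bd abs_ge_self]
        by (simp only: prod.case real_norm_def abs_of_nonneg Bochner_Integration.integral_nonneg norm_ge_zero
            eventually_True)
    qed
  qed
  from P.Fubini_integral[OF this] show ?thesis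
    by (simp add: mult_ac flip: integral_mult_right_zero integral_mult_left_zero)
qed

lemma norm_fourier_le: "integrable lebesgue k \<Longrightarrow> cmod (fourier k x) \<le> (\<integral>t. \<bar>k t\<bar> \<partial>lebesgue)"
  unfolding fourier_def using integral_norm_bound[of lebesgue "\<lambda>t. iexp (- (t * x)) * complex_of_real (k t)"]
  by (simp add: norm_mult)

lemma fourier_measurable:
  assumes F: "sets F = sets borel" and k: "k \<in> borel_measurable lebesgue"
  shows "fourier k \<in> borel_measurable F"
proof -
  interpret L: sigma_finite_measure "lebesgue :: real measure" by (rule sigma_finite_lebesgue)
  note k[measurable]
  have id[measurable]: "(\<lambda>x. x) \<in> borel_measurable F" "(\<lambda>x. x :: real) \<in> borel_measurable lebesgue"
    using F by (simp_all add: measurable_def sets_eq_imp_space_eq[OF F] measurable_completion)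
  note measurable_compose[OF measurable_fst id(1), measurable] measurable_compose[OF measurable_snd id(2), measurable]
  have "(\<lambda>p. iexp (- (snd p * fst p)) * complex_of_real (k (snd p))) \<in> borel_measurable (F \<Otimes>\<^sub>M lebesgue)"
    by measurable
  then show ?thesis
    unfolding fourier_def[abs_def]
    by (intro L.borel_measurable_lebesgue_integral) (simp add: case_prod_unfold)
qed

lemma cnj_fourier: "cnj (fourier h x) = (CLINT t|lebesgue. iexp (t * x) * complex_of_real (h t))"
proof -
  have "cnj (iexp (- (t * x)) * complex_of_real (h t)) = iexp (t * x) * complex_of_real (h t)" for t
    by (simp add: exp_cnj)
  then show ?thesis
    unfolding fourier_def by (simp only: Bochner_Integration.integral_cnj[symmetric])
qed

text \<open>
  Substitute \<open>C (t - u) = \<integral> e^{itx} e^{-iux} F(dx)\<close>: the integral over \<open>u\<close> produces the Fourier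
  transform of \<open>k\<close>, which is bounded, and then the integral over \<open>t\<close> produces the conjugate of that
  of \<open>h\<close>.
\<close>
lemma spectral_double_integral:
  fixes h k :: "real \<Rightarrow> real"
  assumes h: "integrable lebesgue h" and k: "integrable lebesgue k" and CF: "spectral_measure_of C F"
  shows "complex_of_real (\<integral>t. h t * (\<integral>u. k u * C (t - u) \<partial>lebesgue) \<partial>lebesgue) =
    (CLINT x|F. cnj (fourier h x) * fourier k x)"
proof -
  have F: "finite_measure F" "sets F = sets borel" and C: "complex_of_real (C t) = (CLINT x|F. iexp (t * x))" for t
    using CF by (auto simp: spectral_measure_of_def)
  have idF[measurable]: "(\<lambda>x. x) \<in> borel_measurable F"
    using F(2) by (simp add: measurable_def sets_eq_imp_space_eq[OF F(2)])
  have fm: "fourier k \<in> borel_measurable F"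
    using k by (intro fourier_measurable F) simp
  have inner: "complex_of_real (\<integral>u. k u * C (t - u) \<partial>lebesgue) = (CLINT x|F. iexp (t * x) * fourier k x)" for t
  proof -
    have split: "iexp ((t - u) * x) = iexp (- 1 * u * x) * iexp (t * x)" for u x
      by (simp add: exp_add[symmetric] algebra_simps)
    have "complex_of_real (k u * C (t - u)) =
        complex_of_real (k u) * (CLINT x|F. iexp (- 1 * u * x) * iexp (t * x))" for u
      by (simp only: of_real_mult[of "k u"] C split)
    then have "complex_of_real (\<integral>u. k u * C (t - u) \<partial>lebesgue) =
        (CLINT u|lebesgue. complex_of_real (k u) * (CLINT x|F. iexp (- 1 * u * x) * iexp (t * x)))"
      by (simp only: flip: integral_complex_of_real)
    also have "\<dots> = (CLINT x|F. (CLINT u|lebesgue. iexp (- 1 * u * x) * complex_of_real (k u)) * iexp (t * x))"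
      by (rule iexp_fubini[OF k F, where B = 1]) simp_all
    finally show ?thesis
      by (simp add: fourier_def mult.commute)
  qed
  have outer: "complex_of_real (h t * (\<integral>u. k u * C (t - u) \<partial>lebesgue)) =
      complex_of_real (h t) * (CLINT x|F. iexp (1 * t * x) * fourier k x)" for t
    by (simp only: of_real_mult[of "h t"] inner mult_1)
  have "complex_of_real (\<integral>t. h t * (\<integral>u. k u * C (t - u) \<partial>lebesgue) \<partial>lebesgue) =
      (CLINT t|lebesgue. complex_of_real (h t) * (CLINT x|F. iexp (1 * t * x) * fourier k x))"
    by (simp only: outer flip: integral_complex_of_real)
  also have "\<dots> = (CLINT x|F. (CLINT t|lebesgue. iexp (1 * t * x) * complex_of_real (h t)) * fourier k x)"
    by (rule iexp_fubini[OF h F fm norm_fourier_le[OF k]])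
  finally show ?thesis
    by (simp add: cnj_fourier)
qed

lemma (in gaussian_field) expectation_smear_mult:
  assumes h: "integrable N h" and k: "integrable N k"
  shows "expectation (\<lambda>\<omega>. smear N \<Psi> h \<omega> * smear N \<Psi> k \<omega>) =
    (\<integral>t. h t * (\<integral>u. k u * expectation (\<lambda>\<omega>. \<Psi> t \<omega> * \<Psi> u \<omega>) \<partial>N) \<partial>N)"
proof -
  have "expectation (\<lambda>\<omega>. \<Psi> t \<omega> * smear N \<Psi> k \<omega>) = (\<integral>u. k u * expectation (\<lambda>\<omega>. \<Psi> t \<omega> * \<Psi> u \<omega>) \<partial>N)" for t
    using smear_fubini2(1)[OF k L4_field[of t]] by (simp add: mult.commute)
  then show ?thesis
    using smear_fubini2(1)[OF h L4_smear[OF k]] by simp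
qed

section \<open>Stationary processes and covariances\<close>

text \<open>
  By stationarity the variance is \<open>C 0\<close> at all times, hence \<open>3 (C 0)^2\<close> is the fourth moment.
\<close>
lemma stationary_gaussian_field:
  assumes M: "prob_space M" and meas: "(\<lambda>(t, \<omega>). \<Phi> t \<omega>) \<in> borel_measurable (lebesgue \<Otimes>\<^sub>M M)"
    and G: "gaussian_process M \<Phi>" and S: "stationary_with_covariance M \<Phi> C"
    and \<mu>: "\<And>t. (\<integral>\<omega>. \<Phi> t \<omega> \<partial>M) = \<mu>"
  shows "gaussian_field M lebesgue (\<lambda>t \<omega>. \<Phi> t \<omega> - \<mu>) (3 * (C 0)\<^sup>2)"
proof -
  interpret prob_space M by fact
  interpret L: sigma_finite_measure "lebesgue :: real measure" by (rule sigma_finite_lebesgue)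
  interpret gaussian_moment_space M "lin_combs (\<lambda>t \<omega>. \<Phi> t \<omega> - \<mu>)"
    using centred_gaussian_process_moments[OF G] by (simp add: \<mu>)
  have "expectation (\<lambda>\<omega>. (\<Phi> t \<omega> - \<mu>)\<^sup>2) = C 0" for t
    using S by (auto simp: stationary_with_covariance_def covariance_def \<mu> power2_eq_square dest: spec[of _ t])
  moreover have "kurtosis3 M (\<lambda>\<omega>. \<Phi> t \<omega> - \<mu>)" for t
    using fourth[OF lin_combs_base[of "\<lambda>t \<omega>. \<Phi> t \<omega> - \<mu>" t]] .
  ultimately have "expectation (\<lambda>\<omega>. (\<Phi> t \<omega> - \<mu>) ^ 4) \<le> 3 * (C 0)\<^sup>2" for t
    by (simp add: kurtosis3_def)
  moreover have "L4 M (\<lambda>\<omega>. \<Phi> t \<omega> - \<mu>)" for t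
    using L4[OF lin_combs_base[of "\<lambda>t \<omega>. \<Phi> t \<omega> - \<mu>" t]] .
  moreover have "integrable M (\<Phi> t)" for t
    using gaussian_variable_central_moments(1)[OF gaussian_process_component[OF G]] .
  then have "expectation (\<lambda>\<omega>. \<Phi> t \<omega> - \<mu>) = 0" for t
    by (simp add: \<mu> prob_space)
  moreover have "(\<lambda>(t, \<omega>). \<Phi> t \<omega> - \<mu>) \<in> borel_measurable (lebesgue \<Otimes>\<^sub>M M)"
    using borel_measurable_diff[OF meas, of "\<lambda>_. \<mu>"] by (simp add: case_prod_unfold)
  ultimately show ?thesis
    by unfold_locales auto
qed

lemma (in prob_space) covariance_sum:
  fixes U :: "'i \<Rightarrow> 'a \<Rightarrow> real" and V :: "'j \<Rightarrow> 'a \<Rightarrow> real"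
  assumes "\<And>i. i \<in> I \<Longrightarrow> integrable M (U i)" "\<And>j. j \<in> J \<Longrightarrow> integrable M (V j)"
    and "\<And>i j. i \<in> I \<Longrightarrow> j \<in> J \<Longrightarrow> integrable M (\<lambda>\<omega>. U i \<omega> * V j \<omega>)"
  shows "covariance M (\<lambda>\<omega>. \<Sum>i\<in>I. U i \<omega>) (\<lambda>\<omega>. \<Sum>j\<in>J. V j \<omega>) = (\<Sum>i\<in>I. \<Sum>j\<in>J. covariance M (U i) (V j))"
proof -
  have "integrable M (\<lambda>\<omega>. (U i \<omega> - expectation (U i)) * (V j \<omega> - expectation (V j)))"
    if "i \<in> I" "j \<in> J" for i j
    using assms that by (simp add: left_diff_distrib right_diff_distrib)
  moreover have "((\<Sum>i\<in>I. U i \<omega>) - (\<Sum>i\<in>I. expectation (U i))) * ((\<Sum>j\<in>J. V j \<omega>) - (\<Sum>j\<in>J. expectation (V j))) =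
     (\<Sum>i\<in>I. \<Sum>j\<in>J. (U i \<omega> - expectation (U i)) * (V j \<omega> - expectation (V j)))" for \<omega>
    by (simp only: sum_product flip: sum_subtractf)
  ultimately show ?thesis
    using assms(1,2) by (simp add: covariance_def)
qed

lemma covariance_cong_AE:
  assumes [measurable]: "X \<in> borel_measurable M" "X' \<in> borel_measurable M" "Y \<in> borel_measurable M" "Y' \<in> borel_measurable M"
    and eq: "AE \<omega> in M. X \<omega> = X' \<omega>" "AE \<omega> in M. Y \<omega> = Y' \<omega>"
  shows "covariance M X Y = covariance M X' Y'"
proof -
  have "(\<integral>\<omega>. X \<omega> \<partial>M) = (\<integral>\<omega>. X' \<omega> \<partial>M)" "(\<integral>\<omega>. Y \<omega> \<partial>M) = (\<integral>\<omega>. Y' \<omega> \<partial>M)"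
    using eq by (auto intro: integral_cong_AE)
  then show ?thesis
    unfolding covariance_def using eq by (auto intro!: integral_cong_AE)
qed

section \<open>Wavelet transforms of noisy signals\<close>

text \<open>
  The real or imaginary part of the analysing function. Its integrals against a real signal are the
  components of the conjugate of the wavelet transform.
\<close>
definition wavelet_atom :: "(complex \<Rightarrow> real) \<Rightarrow> (real \<Rightarrow> complex) \<Rightarrow> real \<Rightarrow> real \<Rightarrow> real \<Rightarrow> real" where
  "wavelet_atom p \<psi> t s \<tau> = p (\<psi> ((\<tau> - t) / s)) / sqrt s"

lemma Re_neq_Im: "Re \<noteq> Im"
  by (metis complex.sel(1,2) zero_neq_one)

lemma cmod_square_sum: "(cmod z)\<^sup>2 = (\<Sum>p\<in>{Re, Im}. (p (cnj z))\<^sup>2)"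
  by (simp add: Re_neq_Im cmod_power2)

lemma integrable_rescaled:
  fixes \<psi> :: "real \<Rightarrow> complex"
  assumes "integrable lebesgue \<psi>" "0 < s"
  shows "integrable lebesgue (\<lambda>\<tau>. \<psi> ((\<tau> - t) / s))"
  using lebesgue_integrable_real_affine[OF assms(1), of "1 / s" "- t / s"] assms(2)
  by (simp add: diff_divide_distrib)

lemma integral_rescaled:
  fixes \<psi> :: "real \<Rightarrow> 'b::euclidean_space"
  assumes "0 < s"
  shows "(\<integral>\<tau>. \<psi> ((\<tau> - t) / s) \<partial>lebesgue) = s *\<^sub>R (\<integral>u. \<psi> u \<partial>lebesgue)"
  using assms by (subst lebesgue_integral_real_affine[of s _ t]) auto

lemma wavelet_atom_integrable:
  assumes "integrable lebesgue \<psi>" "0 < s" "p \<in> {Re, Im}"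
  shows "integrable lebesgue (wavelet_atom p \<psi> t s)"
  using integrable_rescaled[OF assms(1,2), of t] assms(3) unfolding wavelet_atom_def[abs_def] by auto

lemma wavelet_atom_integral_zero:
  assumes "mother_wavelet \<psi>" "0 < s" "p \<in> {Re, Im}"
  shows "(\<integral>\<tau>. wavelet_atom p \<psi> t s \<tau> \<partial>lebesgue) = 0"
proof -
  have i: "integrable lebesgue \<psi>" and z: "(CLINT u|lebesgue. \<psi> u) = 0"
    using assms(1) by (auto simp: mother_wavelet_def)
  have "p (CLINT \<tau>|lebesgue. \<psi> ((\<tau> - t) / s)) = (\<integral>\<tau>. p (\<psi> ((\<tau> - t) / s)) \<partial>lebesgue)"
    using integrable_rescaled[OF i assms(2), of t] assms(3) by auto
  moreover have "(CLINT \<tau>|lebesgue. \<psi> ((\<tau> - t) / s)) = 0"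
    by (simp add: integral_rescaled[OF assms(2)] z)
  ultimately show ?thesis
    using assms(3) by (auto simp: wavelet_atom_def)
qed

lemma fourier_wavelet_atom:
  assumes s: "0 < s"
  shows "fourier (wavelet_atom p \<psi> t s) x = complex_of_real (sqrt s) * iexp (- (t * x)) * fourier (\<lambda>u. p (\<psi> u)) (s * x)"
proof -
  have e: "iexp (- ((t + s * u) * x)) = iexp (- (t * x)) * iexp (- (u * (s * x)))" for u
    by (simp add: exp_add[symmetric] algebra_simps)
  have "fourier (wavelet_atom p \<psi> t s) x =
     s *\<^sub>R (CLINT u|lebesgue. iexp (- ((t + s * u) * x)) * complex_of_real (wavelet_atom p \<psi> t s (t + s * u)))"
    unfolding fourier_def using s by (subst lebesgue_integral_real_affine[of s _ t]) auto
  also have "\<dots> = s *\<^sub>R (CLINT u|lebesgue. (iexp (- (t * x)) / complex_of_real (sqrt s)) * (iexp (- (u * (s * x))) * complex_of_real (p (\<psi> u))))"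
    unfolding e using s by (simp add: wavelet_atom_def mult.assoc)
  also have "\<dots> = s *\<^sub>R (iexp (- (t * x)) / complex_of_real (sqrt s)) * fourier (\<lambda>u. p (\<psi> u)) (s * x)"
    unfolding fourier_def by (simp only: integral_mult_right_zero mult_scaleR_left)
  also have "s *\<^sub>R (iexp (- (t * x)) / complex_of_real (sqrt s)) = complex_of_real (s / sqrt s) * iexp (- (t * x))"
    by (simp add: scaleR_conv_of_real)
  finally show ?thesis using s by (simp add: real_div_sqrt)
qed

lemma cnj_wavelet_transform_component:
  assumes int: "\<And>p. p \<in> {Re, Im} \<Longrightarrow> integrable lebesgue (\<lambda>\<tau>. wavelet_atom p \<psi> t s \<tau> * g \<tau>)" and p: "p \<in> {Re, Im}"
  shows "p (cnj (wavelet_transform \<psi> g t s)) = (\<integral>\<tau>. wavelet_atom p \<psi> t s \<tau> * g \<tau> \<partial>lebesgue)"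
proof -
  let ?G = "\<lambda>\<tau>. Complex (wavelet_atom Re \<psi> t s \<tau> * g \<tau>) (wavelet_atom Im \<psi> t s \<tau> * g \<tau>)"
  have G: "?G \<tau> = cnj (complex_of_real (g \<tau>) * complex_of_real (1 / sqrt s) * cnj (\<psi> ((\<tau> - t) / s)))" for \<tau>
    by (simp add: complex_eq_iff wavelet_atom_def)
  have "integrable lebesgue ?G"
    unfolding Complex_eq
    by (intro Bochner_Integration.integrable_add integrable_mult_right integrable_of_real int) auto
  moreover have "cnj (wavelet_transform \<psi> g t s) = (CLINT \<tau>|lebesgue. ?G \<tau>)"
    unfolding G wavelet_transform_def by (simp only: Bochner_Integration.integral_cnj)
  ultimately show ?thesis
    using p integral_Re[of lebesgue ?G] integral_Im[of lebesgue ?G] by (auto simp del: integral_Re integral_Im)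
qed

lemma wavelet_transform_measurable:
  assumes \<Phi>: "(\<lambda>(t, \<omega>). \<Phi> t \<omega>) \<in> borel_measurable (lebesgue \<Otimes>\<^sub>M M)"
    and f: "f \<in> borel_measurable lebesgue" and \<psi>: "integrable lebesgue \<psi>" and s: "0 < s"
  shows "(\<lambda>\<omega>. wavelet_transform \<psi> (\<lambda>\<tau>. f \<tau> + \<Phi> \<tau> \<omega>) t s) \<in> borel_measurable M"
proof -
  interpret L: sigma_finite_measure "lebesgue :: real measure" by (rule sigma_finite_lebesgue)
  have [measurable]: "(\<lambda>(\<omega>, \<tau>). \<Phi> \<tau> \<omega>) \<in> borel_measurable (M \<Otimes>\<^sub>M lebesgue)"
    using measurable_compose[OF measurable_pair_swap' \<Phi>] by (simp add: case_prod_unfold)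
  note f[measurable]
  have "(\<lambda>\<tau>. \<psi> ((\<tau> - t) / s)) \<in> borel_measurable lebesgue"
    using integrable_rescaled[OF \<psi> s, of t] by simp
  from measurable_compose[OF measurable_snd this]
  have [measurable]: "(\<lambda>x. cnj (\<psi> ((snd x - t) / s))) \<in> borel_measurable (M \<Otimes>\<^sub>M lebesgue)"
    by (intro borel_measurable_continuous_on[OF continuous_on_cnj[OF continuous_on_id]])
  have "(\<lambda>(\<omega>, \<tau>). complex_of_real (f \<tau> + \<Phi> \<tau> \<omega>) * complex_of_real (1 / sqrt s) * cnj (\<psi> ((\<tau> - t) / s)))
      \<in> borel_measurable (M \<Otimes>\<^sub>M lebesgue)"
    by measurable
  then show ?thesis
    unfolding wavelet_transform_def by (rule L.borel_measurable_lebesgue_integral)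
qed

lemma integrable_atom_mult_bounded:
  assumes \<psi>: "integrable lebesgue \<psi>" and s: "0 < s" and p: "p \<in> {Re, Im}"
    and f: "f \<in> borel_measurable lebesgue" "bounded (range f)"
  shows "integrable lebesgue (\<lambda>\<tau>. wavelet_atom p \<psi> t s \<tau> * f \<tau> :: real)"
proof -
  note i = wavelet_atom_integrable[OF \<psi> s p, of t]
  obtain B where B: "\<And>\<tau>. \<bar>f \<tau>\<bar> \<le> B"
    using f(2) by (auto simp: bounded_iff)
  show ?thesis
  proof (rule Bochner_Integration.integrable_bound)
    show "integrable lebesgue (\<lambda>\<tau>. wavelet_atom p \<psi> t s \<tau> * B)" using i by simp
    show "(\<lambda>\<tau>. wavelet_atom p \<psi> t s \<tau> * f \<tau>) \<in> borel_measurable lebesgue"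
      using i f(1) by simp
    show "AE \<tau> in lebesgue. norm (wavelet_atom p \<psi> t s \<tau> * f \<tau>) \<le> norm (wavelet_atom p \<psi> t s \<tau> * B)"
      using B by (auto simp: abs_mult intro!: mult_left_mono order_trans[OF B abs_ge_self])
  qed
qed

text \<open>
  The wavelet has integral zero, so the mean of the noise drops out and the noise enters only through
  the centred field. The identity holds almost surely only, because the paths of the noise need be
  integrable against the wavelet only almost surely.
\<close>
lemma noisy_wavelet_component:
  assumes G: "gaussian_field M lebesgue (\<lambda>t \<omega>. \<Phi> t \<omega> - \<mu>) K"
    and \<psi>: "mother_wavelet \<psi>" and s: "0 < s"
    and f: "f \<in> borel_measurable lebesgue" "bounded (range f)"
  shows "AE \<omega> in M. \<forall>p\<in>{Re, Im}. p (cnj (wavelet_transform \<psi> (\<lambda>\<tau>. f \<tau> + \<Phi> \<tau> \<omega>) t s)) =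
    p (cnj (wavelet_transform \<psi> f t s)) + smear lebesgue (\<lambda>t \<omega>. \<Phi> t \<omega> - \<mu>) (wavelet_atom p \<psi> t s) \<omega>"
proof -
  interpret gaussian_field M lebesgue "\<lambda>t \<omega>. \<Phi> t \<omega> - \<mu>" K by fact
  have i: "integrable lebesgue \<psi>" using \<psi> by (simp add: mother_wavelet_def)
  note atom = wavelet_atom_integrable[OF i s, of _ t]
  note fi = integrable_atom_mult_bounded[OF i s _ f, of _ t]
  have "AE \<omega> in M. \<forall>p\<in>{Re, Im}. integrable lebesgue (\<lambda>\<tau>. wavelet_atom p \<psi> t s \<tau> * (\<Phi> \<tau> \<omega> - \<mu>))"
    using smear_fubini(1)[OF atom L4_one L4_one L4_one] by simp
  then show ?thesis
  proof eventually_elim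
    case (elim \<omega>)
    have eq: "wavelet_atom p \<psi> t s \<tau> * (f \<tau> + \<Phi> \<tau> \<omega>) =
        wavelet_atom p \<psi> t s \<tau> * f \<tau> + wavelet_atom p \<psi> t s \<tau> * (\<Phi> \<tau> \<omega> - \<mu>) + wavelet_atom p \<psi> t s \<tau> * \<mu>" for p \<tau>
      by (simp add: algebra_simps)
    have iY: "integrable lebesgue (\<lambda>\<tau>. wavelet_atom p \<psi> t s \<tau> * (f \<tau> + \<Phi> \<tau> \<omega>))" if p: "p \<in> {Re, Im}" for p
      unfolding eq using elim fi[OF p] atom[OF p] p by (intro Bochner_Integration.integrable_add) auto
    show ?case
    proof
      fix p :: "complex \<Rightarrow> real" assume p: "p \<in> {Re, Im}"
      have ie: "integrable lebesgue (\<lambda>\<tau>. wavelet_atom p \<psi> t s \<tau> * (\<Phi> \<tau> \<omega> - \<mu>))"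
        using elim p by blast
      have "p (cnj (wavelet_transform \<psi> (\<lambda>\<tau>. f \<tau> + \<Phi> \<tau> \<omega>) t s)) =
          (\<integral>\<tau>. wavelet_atom p \<psi> t s \<tau> * f \<tau> + wavelet_atom p \<psi> t s \<tau> * (\<Phi> \<tau> \<omega> - \<mu>) + wavelet_atom p \<psi> t s \<tau> * \<mu> \<partial>lebesgue)"
        using cnj_wavelet_transform_component[OF iY p] by (simp only: eq)
      moreover have "p (cnj (wavelet_transform \<psi> f t s)) = (\<integral>\<tau>. wavelet_atom p \<psi> t s \<tau> * f \<tau> \<partial>lebesgue)"
        by (rule cnj_wavelet_transform_component[OF fi p])
      moreover have "(\<integral>\<tau>. wavelet_atom p \<psi> t s \<tau> * f \<tau> + wavelet_atom p \<psi> t s \<tau> * (\<Phi> \<tau> \<omega> - \<mu>) + wavelet_atom p \<psi> t s \<tau> * \<mu> \<partial>lebesgue) =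
          (\<integral>\<tau>. wavelet_atom p \<psi> t s \<tau> * f \<tau> \<partial>lebesgue) +
          (\<integral>\<tau>. wavelet_atom p \<psi> t s \<tau> * (\<Phi> \<tau> \<omega> - \<mu>) \<partial>lebesgue)"
        using fi[OF p] ie atom[OF p] wavelet_atom_integral_zero[OF \<psi> s p, of t] by simp
      ultimately show "p (cnj (wavelet_transform \<psi> (\<lambda>\<tau>. f \<tau> + \<Phi> \<tau> \<omega>) t s)) =
          p (cnj (wavelet_transform \<psi> f t s)) + smear lebesgue (\<lambda>t \<omega>. \<Phi> t \<omega> - \<mu>) (wavelet_atom p \<psi> t s) \<omega>"
        by (simp only: smear_def)
    qed
  qed
qed

text \<open>
  The translations \<open>t1\<close>, \<open>t2\<close> contribute the phase and the normalisations \<open>1 / sqrt s\<close> together with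
  the dilations contribute \<open>sqrt (s1 * s2)\<close>.
\<close>
lemma smeared_atoms_covariance:
  assumes G: "gaussian_field M lebesgue \<Psi> K"
    and C: "\<And>t u. (\<integral>\<omega>. \<Psi> t \<omega> * \<Psi> u \<omega> \<partial>M) = C (t - u)" and CF: "spectral_measure_of C F"
    and \<psi>: "integrable lebesgue \<psi>" and s: "0 < s1" "0 < s2" and pq: "p \<in> {Re, Im}" "q \<in> {Re, Im}"
  shows "complex_of_real (\<integral>\<omega>. smear lebesgue \<Psi> (wavelet_atom p \<psi> t1 s1) \<omega> * smear lebesgue \<Psi> (wavelet_atom q \<psi> t2 s2) \<omega> \<partial>M) =
    complex_of_real (sqrt (s1 * s2)) * (CLINT x|F. iexp ((t1 - t2) * x) *
      cnj (fourier (\<lambda>u. p (\<psi> u)) (s1 * x)) * fourier (\<lambda>u. q (\<psi> u)) (s2 * x))"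
proof -
  interpret gaussian_field M lebesgue \<Psi> K by fact
  note i = wavelet_atom_integrable[OF \<psi> s(1) pq(1), of t1] wavelet_atom_integrable[OF \<psi> s(2) pq(2), of t2]
  have "cnj (fourier (wavelet_atom p \<psi> t1 s1) x) * fourier (wavelet_atom q \<psi> t2 s2) x =
    complex_of_real (sqrt (s1 * s2)) * (iexp ((t1 - t2) * x) *
      cnj (fourier (\<lambda>u. p (\<psi> u)) (s1 * x)) * fourier (\<lambda>u. q (\<psi> u)) (s2 * x))" for x
  proof -
    have "iexp ((t1 - t2) * x) = cnj (iexp (- (t1 * x))) * iexp (- (t2 * x))"
      by (simp add: exp_cnj exp_add[symmetric] algebra_simps)
    then show ?thesis
      unfolding fourier_wavelet_atom[OF s(1)] fourier_wavelet_atom[OF s(2)]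
      by (simp only: complex_cnj_mult complex_cnj_complex_of_real real_sqrt_mult of_real_mult[of "sqrt s1" "sqrt s2"] mult_ac)
  qed
  then show ?thesis
    unfolding expectation_smear_mult[OF i] C spectral_double_integral[OF i CF] by simp
qed

section \<open>Covariance of the scalogram\<close>

theorem proposition6:
  fixes M :: "'a measure"
    and \<Phi> :: "real \<Rightarrow> 'a \<Rightarrow> real"
    and C :: "real \<Rightarrow> real"
    and F :: "real measure"
    and f :: "real \<Rightarrow> real"
    and \<psi> :: "real \<Rightarrow> complex"
    and t1 t2 s1 s2 :: real
  assumes "prob_space M"
    and "(\<lambda>(t, \<omega>). \<Phi> t \<omega>) \<in> borel_measurable (lebesgue \<Otimes>\<^sub>M M)"
    and "gaussian_process M \<Phi>"
    and "stationary_with_covariance M \<Phi> C"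
    and "spectral_measure_of C F"
    and "f \<in> borel_measurable lebesgue"
    and "bounded (range f)"
    and "mother_wavelet \<psi>"
    and "0 < s1" and "0 < s2"
  shows "complex_of_real (covariance M
           (\<lambda>\<omega>. (cmod (wavelet_transform \<psi> (\<lambda>\<tau>. f \<tau> + \<Phi> \<tau> \<omega>) t1 s1))\<^sup>2)
           (\<lambda>\<omega>. (cmod (wavelet_transform \<psi> (\<lambda>\<tau>. f \<tau> + \<Phi> \<tau> \<omega>) t2 s2))\<^sup>2)) =
    (\<Sum>p\<in>{Re, Im}. \<Sum>q\<in>{Re, Im}.
       4 * complex_of_real (p (cnj (wavelet_transform \<psi> f t1 s1))) *
         complex_of_real (q (cnj (wavelet_transform \<psi> f t2 s2))) * complex_of_real (sqrt (s1 * s2)) *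
         (CLINT x|F. iexp ((t1 - t2) * x) *
            cnj (fourier (\<lambda>u. p (\<psi> u)) (s1 * x)) * fourier (\<lambda>u. q (\<psi> u)) (s2 * x)) +
       2 * complex_of_real (s1 * s2) *
         (CLINT u|F. iexp ((t1 - t2) * u) *
            cnj (fourier (\<lambda>v. p (\<psi> v)) (s1 * u)) * fourier (\<lambda>v. q (\<psi> v)) (s2 * u))\<^sup>2)"
proof -
  obtain \<mu> where \<mu>: "\<And>t. (\<integral>\<omega>. \<Phi> t \<omega> \<partial>M) = \<mu>"
    using assms(4) by (auto simp: stationary_with_covariance_def)
  define \<Psi> where "\<Psi> = (\<lambda>t \<omega>. \<Phi> t \<omega> - \<mu>)"
  have G: "gaussian_field M lebesgue \<Psi> (3 * (C 0)\<^sup>2)"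
    unfolding \<Psi>_def by (rule stationary_gaussian_field[OF assms(1-4) \<mu>])
  then interpret gaussian_field M lebesgue \<Psi> "3 * (C 0)\<^sup>2" .
  have \<psi>: "integrable lebesgue \<psi>"
    using assms(8) by (simp add: mother_wavelet_def)
  have cov: "expectation (\<lambda>\<omega>. \<Psi> t \<omega> * \<Psi> u \<omega>) = C (t - u)" for t u
    using assms(4) by (auto simp: stationary_with_covariance_def covariance_def \<mu> \<Psi>_def)
  define a where "a = (\<lambda>p. p (cnj (wavelet_transform \<psi> f t1 s1)) :: real)"
  define b where "b = (\<lambda>p. p (cnj (wavelet_transform \<psi> f t2 s2)) :: real)"
  define X where "X = (\<lambda>p. smear lebesgue \<Psi> (wavelet_atom p \<psi> t1 s1))"
  define Y where "Y = (\<lambda>p. smear lebesgue \<Psi> (wavelet_atom p \<psi> t2 s2))"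
  define I where "I = (\<lambda>p q. CLINT x|F. iexp ((t1 - t2) * x) *
            cnj (fourier (\<lambda>u. p (\<psi> u)) (s1 * x)) * fourier (\<lambda>u. q (\<psi> u)) (s2 * x))"
  note h = wavelet_atom_integrable[OF \<psi> assms(9), of _ t1]
  note k = wavelet_atom_integrable[OF \<psi> assms(10), of _ t2]
  have LX: "L4 M (\<lambda>\<omega>. a p + X p \<omega>)" and LY: "L4 M (\<lambda>\<omega>. b p + Y p \<omega>)" if "p \<in> {Re, Im}" for p
    unfolding X_def Y_def using that by (intro L4_add L4_const L4_smear h k; assumption)+
  have "covariance M
           (\<lambda>\<omega>. (cmod (wavelet_transform \<psi> (\<lambda>\<tau>. f \<tau> + \<Phi> \<tau> \<omega>) t1 s1))\<^sup>2)
           (\<lambda>\<omega>. (cmod (wavelet_transform \<psi> (\<lambda>\<tau>. f \<tau> + \<Phi> \<tau> \<omega>) t2 s2))\<^sup>2) =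
        covariance M (\<lambda>\<omega>. \<Sum>p\<in>{Re, Im}. (a p + X p \<omega>)\<^sup>2) (\<lambda>\<omega>. \<Sum>q\<in>{Re, Im}. (b q + Y q \<omega>)\<^sup>2)"
  proof (rule covariance_cong_AE)
    note [measurable] = wavelet_transform_measurable[OF assms(2,6) \<psi> assms(9), of t1]
      wavelet_transform_measurable[OF assms(2,6) \<psi> assms(10), of t2]
    show "(\<lambda>\<omega>. (cmod (wavelet_transform \<psi> (\<lambda>\<tau>. f \<tau> + \<Phi> \<tau> \<omega>) t1 s1))\<^sup>2) \<in> borel_measurable M"
      "(\<lambda>\<omega>. (cmod (wavelet_transform \<psi> (\<lambda>\<tau>. f \<tau> + \<Phi> \<tau> \<omega>) t2 s2))\<^sup>2) \<in> borel_measurable M"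
      by measurable
    show "(\<lambda>\<omega>. \<Sum>p\<in>{Re, Im}. (a p + X p \<omega>)\<^sup>2) \<in> borel_measurable M"
      "(\<lambda>\<omega>. \<Sum>q\<in>{Re, Im}. (b q + Y q \<omega>)\<^sup>2) \<in> borel_measurable M"
      by (intro borel_measurable_sum borel_measurable_power L4_measurable LX LY; assumption)+
    show "AE \<omega> in M. (cmod (wavelet_transform \<psi> (\<lambda>\<tau>. f \<tau> + \<Phi> \<tau> \<omega>) t1 s1))\<^sup>2 = (\<Sum>p\<in>{Re, Im}. (a p + X p \<omega>)\<^sup>2)"
      using noisy_wavelet_component[OF G[unfolded \<Psi>_def] assms(8,9,6,7), of t1]
      unfolding cmod_square_sum a_def X_def \<Psi>_def
      by eventually_elim (intro sum.cong refl arg_cong[where f = "\<lambda>x. x\<^sup>2"], blast)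
    show "AE \<omega> in M. (cmod (wavelet_transform \<psi> (\<lambda>\<tau>. f \<tau> + \<Phi> \<tau> \<omega>) t2 s2))\<^sup>2 = (\<Sum>q\<in>{Re, Im}. (b q + Y q \<omega>)\<^sup>2)"
      using noisy_wavelet_component[OF G[unfolded \<Psi>_def] assms(8,10,6,7), of t2]
      unfolding cmod_square_sum b_def Y_def \<Psi>_def
      by eventually_elim (intro sum.cong refl arg_cong[where f = "\<lambda>x. x\<^sup>2"], blast)
  qed
  also have "\<dots> = (\<Sum>p\<in>{Re, Im}. \<Sum>q\<in>{Re, Im}. covariance M (\<lambda>\<omega>. (a p + X p \<omega>)\<^sup>2) (\<lambda>\<omega>. (b q + Y q \<omega>)\<^sup>2))"
  proof (rule covariance_sum)
    fix p q :: "complex \<Rightarrow> real" assume pq: "p \<in> {Re, Im}" "q \<in> {Re, Im}"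
    note L = LX[OF pq(1)] LY[OF pq(2)]
    show "integrable M (\<lambda>\<omega>. (a p + X p \<omega>)\<^sup>2)" "integrable M (\<lambda>\<omega>. (b q + Y q \<omega>)\<^sup>2)"
      "integrable M (\<lambda>\<omega>. (a p + X p \<omega>)\<^sup>2 * (b q + Y q \<omega>)\<^sup>2)"
      using L4_integrable_mult2[OF L(1,1)] L4_integrable_mult2[OF L(2,2)] L4_integrable_mult4[OF L(1,1,2,2)]
      by (simp_all only: power2_eq_square mult.assoc)
  qed
  also have "\<dots> = (\<Sum>p\<in>{Re, Im}. \<Sum>q\<in>{Re, Im}.
      4 * a p * b q * expectation (\<lambda>\<omega>. X p \<omega> * Y q \<omega>) + 2 * (expectation (\<lambda>\<omega>. X p \<omega> * Y q \<omega>))\<^sup>2)"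
    unfolding X_def Y_def by (intro sum.cong refl covariance_shifted_squares h k)
  finally have "complex_of_real (covariance M
           (\<lambda>\<omega>. (cmod (wavelet_transform \<psi> (\<lambda>\<tau>. f \<tau> + \<Phi> \<tau> \<omega>) t1 s1))\<^sup>2)
           (\<lambda>\<omega>. (cmod (wavelet_transform \<psi> (\<lambda>\<tau>. f \<tau> + \<Phi> \<tau> \<omega>) t2 s2))\<^sup>2)) =
     (\<Sum>p\<in>{Re, Im}. \<Sum>q\<in>{Re, Im}. 4 * complex_of_real (a p) * complex_of_real (b q) *
         complex_of_real (expectation (\<lambda>\<omega>. X p \<omega> * Y q \<omega>)) +
       2 * (complex_of_real (expectation (\<lambda>\<omega>. X p \<omega> * Y q \<omega>)))\<^sup>2)"
    by (simp only: of_real_sum of_real_add of_real_mult of_real_power of_real_numeral)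
  also have "\<dots> = (\<Sum>p\<in>{Re, Im}. \<Sum>q\<in>{Re, Im}.
       4 * complex_of_real (a p) * complex_of_real (b q) * complex_of_real (sqrt (s1 * s2)) * I p q +
       2 * complex_of_real (s1 * s2) * (I p q)\<^sup>2)"
  proof (intro sum.cong refl)
    fix p q :: "complex \<Rightarrow> real" assume pq: "p \<in> {Re, Im}" "q \<in> {Re, Im}"
    have XY: "complex_of_real (expectation (\<lambda>\<omega>. X p \<omega> * Y q \<omega>)) = complex_of_real (sqrt (s1 * s2)) * I p q"
      unfolding X_def Y_def I_def by (rule smeared_atoms_covariance[OF G cov assms(5) \<psi> assms(9,10) pq])
    have "(complex_of_real (sqrt (s1 * s2)))\<^sup>2 = complex_of_real (s1 * s2)"
      using assms(9,10) by (simp only: flip: of_real_power) simp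
    then show "4 * complex_of_real (a p) * complex_of_real (b q) *
         complex_of_real (expectation (\<lambda>\<omega>. X p \<omega> * Y q \<omega>)) +
       2 * (complex_of_real (expectation (\<lambda>\<omega>. X p \<omega> * Y q \<omega>)))\<^sup>2 =
       4 * complex_of_real (a p) * complex_of_real (b q) * complex_of_real (sqrt (s1 * s2)) * I p q +
       2 * complex_of_real (s1 * s2) * (I p q)\<^sup>2"
      unfolding XY by (simp only: power_mult_distrib mult.assoc)
  qed
  finally show ?thesis
    unfolding a_def b_def I_def .
qed

end
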